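(* $R_2(F_3)=14$.
   Context: All graphs are finite, simple and undirected. For a graph $H$, the diagonal Ramsey number $R_2(H)=R(H,H)$ is the smallest integer $N$ such that every coloring of the edges of the complete graph $K_N$ with the two colors red and blue contains a monochromatic copy of $H$ (a subgraph isomorphic to $H$, not necessarily induced, all of whose edges have the same color). The fan $F_n$ is the graph on $2n+1$ vertices consisting of $n$ triangles that share exactly one common vertex and are otherwise vertex-disjoint; thus $F_3$ has $7$ vertices and is a single vertex joined to all vertices of a disjoint union of three copies of $K_2$. *)

theory Defs
  imports "HOL-Library.Ramsey"
begin

text \<open>A graph is a pair of a vertex set and a set of edges, the edges being two-element sets
  of vertices; \<open>[V]\<^bsup>2\<^esup>\<close> is the library's set of two-element subsets.\<close>

type_synonym 'a ugraph = "'a set \<times> 'a set set"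

abbreviation verts :: "'a ugraph \<Rightarrow> 'a set" where "verts \<equiv> fst"
abbreviation edges :: "'a ugraph \<Rightarrow> 'a set set" where "edges \<equiv> snd"

definition simple_graph :: "'a ugraph \<Rightarrow> bool" where
  "simple_graph G \<longleftrightarrow> finite (verts G) \<and> edges G \<subseteq> [verts G]\<^bsup>2\<^esup>"

definition subgraph :: "'a ugraph \<Rightarrow> 'a ugraph \<Rightarrow> bool" where
  "subgraph K G \<longleftrightarrow> simple_graph K \<and> simple_graph G \<and> verts K \<subseteq> verts G \<and> edges K \<subseteq> edges G"

definition graph_iso :: "'a ugraph \<Rightarrow> 'b ugraph \<Rightarrow> bool" where
  "graph_iso G H \<longleftrightarrow> (\<exists>f. bij_betw f (verts G) (verts H) \<and>
     (\<forall>u\<in>verts G. \<forall>v\<in>verts G. {u, v} \<in> edges G \<longleftrightarrow> {f u, f v} \<in> edges H))"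

definition complete_graph :: "nat \<Rightarrow> nat ugraph" where
  "complete_graph N = ({..<N}, [{..<N}]\<^bsup>2\<^esup>)"

datatype colour = Red | Blue

text \<open>A colouring is a total function on sets of vertices; only its values on the edges of the
  ambient graph matter.\<close>

definition mono_copy :: "'a ugraph \<Rightarrow> ('a set \<Rightarrow> colour) \<Rightarrow> 'b ugraph \<Rightarrow> bool" where
  "mono_copy G \<chi> H \<longleftrightarrow>
     (\<exists>K c. subgraph K G \<and> graph_iso H K \<and> (\<forall>e\<in>edges K. \<chi> e = c))"

text \<open>The set over which the minimum is taken is nonempty for every simple graph, see
  \<open>ramsey_number_attained\<close> below.\<close>

definition ramsey_number :: "'a ugraph \<Rightarrow> nat" where
  "ramsey_number H = (LEAST N. \<forall>\<chi>. mono_copy (complete_graph N) \<chi> H)"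

text \<open>The \<open>i\<close>-th triangle of the fan has vertices \<open>0\<close>, \<open>2 * i + 1\<close>, \<open>2 * i + 2\<close>; the common
  vertex is \<open>0\<close>.\<close>

definition fan :: "nat \<Rightarrow> nat ugraph" where
  "fan n = ({..2 * n}, \<Union>i<n. [{0, 2 * i + 1, 2 * i + 2}]\<^bsup>2\<^esup>)"

lemma simple_graph_fan: "simple_graph (fan n)"
proof -
  have "[{0, 2 * i + 1, 2 * i + 2}]\<^bsup>2\<^esup> \<subseteq> [{..2 * n}]\<^bsup>2\<^esup>" if "i < n" for i
    using that by (intro nsets_mono) auto
  then show ?thesis
    by (auto simp: simple_graph_def fan_def)
qed

lemma card_verts_fan: "card (verts (fan n)) = 2 * n + 1"
  by (simp add: fan_def)

lemma edges_fan_3: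
  "edges (fan 3) = {{0, v} | v. v \<in> {1..6}} \<union> {{1, 2}, {3, 4}, {5, 6}}"
proof -
  have tri: "[{0, 2 * i + 1, 2 * i + 2}]\<^bsup>2\<^esup> = {{0, 2 * i + 1}, {0, 2 * i + 2}, {2 * i + 1, 2 * i + 2}}"
    for i :: nat
    unfolding nsets_2_eq by (simp add: insert_Diff_if insert_commute)
  have "edges (fan 3) = (\<Union>i\<in>{0, 1, 2}. {{0, 2 * i + 1}, {0, 2 * i + 2}, {2 * i + 1, 2 * i + 2}})"
    unfolding fan_def snd_conv tri by (simp add: lessThan_nat_numeral lessThan_Suc insert_commute)
  also have "\<dots> = (\<lambda>v. {0, v}) ` {1, 2, 3, 4, 5, 6} \<union> {{1, 2}, {3, 4}, {5, 6}}"
    by (simp add: insert_commute eval_nat_numeral)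
  also have "{1, 2, 3, 4, 5, 6} = {1..6::nat}"
    by auto
  finally show ?thesis
    by (simp only: Setcompr_eq_image Collect_mem_eq)
qed

lemma ramsey_number_attained:
  fixes H :: "'a ugraph"
  assumes H: "simple_graph H"
  shows "\<forall>\<chi>. mono_copy (complete_graph (ramsey_number H)) \<chi> H"
proof -
  let ?m = "card (verts H)"
  obtain N :: nat where N: "partn_lst {..<N} [?m, ?m] 2"
    using ramsey2_full by blast
  have "mono_copy (complete_graph N) \<chi> H" for \<chi>
  proof -
    let ?f = "\<lambda>e. if \<chi> e = Red then 0 else Suc 0"
    have "?f \<in> [{..<N}]\<^bsup>2\<^esup> \<rightarrow> {..<length [?m, ?m]}"
      by auto
    then obtain i where "i < 2" "monochromatic {..<N} ([?m, ?m] ! i) 2 ?f i"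
      using N unfolding partn_lst_def by (metis length_Cons list.size(3) numeral_2_eq_2)
    then have "monochromatic {..<N} ?m 2 ?f i"
      by (auto simp: less_2_cases_iff)
    then obtain S where S: "S \<subseteq> {..<N}" "finite S" "card S = ?m" and mono: "?f ` [S]\<^bsup>2\<^esup> \<subseteq> {i}"
      by (auto simp: monochromatic_def nsets_def)
    obtain g where g: "bij_betw g (verts H) S"
      using H S by (metis finite_same_card_bij simple_graph_def)
    let ?K = "(S, (`) g ` edges H)"
    have HE: "e \<in> [verts H]\<^bsup>2\<^esup>" if "e \<in> edges H" for e
      using that H by (auto simp: simple_graph_def)
    have KE: "(`) g ` edges H \<subseteq> [S]\<^bsup>2\<^esup>"
    proof clarify
      fix e assume "e \<in> edges H"
      then obtain u v where "e = {u, v}" "u \<in> verts H" "v \<in> verts H" "u \<noteq> v"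
        by (meson HE nsets2_E)
      then show "g ` e \<in> [S]\<^bsup>2\<^esup>"
        using g by (auto simp: bij_betw_def inj_on_def)
    qed
    have "subgraph ?K (complete_graph N)"
      using S KE nsets_mono[OF S(1), of 2]
      by (auto simp: subgraph_def simple_graph_def complete_graph_def)
    moreover have "graph_iso H ?K"
      unfolding graph_iso_def
    proof (intro exI[of _ g] conjI ballI)
      show "bij_betw g (verts H) (verts ?K)"
        using g by simp
      fix u v assume uv: "u \<in> verts H" "v \<in> verts H"
      have "{u, v} \<in> edges H" if "e \<in> edges H" "{g u, g v} = g ` e" for e
      proof -
        have "e \<subseteq> verts H"
          using HE[OF that(1)] by (simp add: nsets_def)
        then have "e = {u, v}"
          using inj_on_image_eq_iff[of g "verts H" e "{u, v}"] g uv that(2)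
          by (auto simp: bij_betw_def)
        then show ?thesis
          using that(1) by simp
      qed
      moreover have "{g u, g v} \<in> (`) g ` edges H" if "{u, v} \<in> edges H"
        using that by (metis image_empty image_eqI image_insert)
      ultimately show "{u, v} \<in> edges H \<longleftrightarrow> {g u, g v} \<in> edges ?K"
        by auto
    qed
    moreover have "\<forall>e\<in>edges ?K. \<chi> e = (if i = 0 then Red else Blue)"
    proof
      fix e assume "e \<in> edges ?K"
      then have "e \<in> [S]\<^bsup>2\<^esup>"
        using KE by auto
      then have "?f e = i"
        using mono by blast
      then show "\<chi> e = (if i = 0 then Red else Blue)"
        by (cases "\<chi> e") auto
    qed
    ultimately show ?thesis
      unfolding mono_copy_def by blast
  qed
  then show ?thesis
    unfolding ramsey_number_def by (intro LeastI[of "\<lambda>N. \<forall>\<chi>. mono_copy (complete_graph N) \<chi> H"]) blast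
qed

end

theory Submission
  imports Defs
begin

text \<open>
  For a colour \<open>c\<close>, a fan with centre \<open>v\<close> is the same thing as three disjoint \<open>c\<close>-edges among the
  \<open>c\<close>-neighbours of \<open>v\<close>. Hence a colouring without a monochromatic fan is one in which, for both
  colours \<open>c\<close> and all \<open>v\<close>, the colour-\<open>c\<close> graph on the \<open>c\<close>-neighbourhood of \<open>v\<close> has matching
  number at most two. By the Tutte-Berge formula this is a rigid condition: all edges meet two
  vertices, or all edges avoiding one vertex lie in a triple, or all edges lie in a set of five,
  or all edges lie in two disjoint triples (\<open>no_matching3_cases\<close>). In each case the neighbourhood
  is full of edges of the other colour.

  Upper bound. Suppose that \<open>K\<^sub>1\<^sub>4\<close> is coloured without a monochromatic fan; call \<open>c\<close> red and the
  other colour blue, with the roles interchangeable. The engine is \<open>no_sparse_5_8\<close>: there are no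
  disjoint sets \<open>Q\<close> of five and \<open>W\<close> of eight vertices such that every vertex of \<open>W\<close> sends at most
  one blue edge to \<open>Q\<close>. A vertex of \<open>W\<close> with three red neighbours in \<open>W\<close> would be the centre of a
  red fan whose blades join \<open>W\<close> to \<open>Q\<close>, and a vertex with six blue neighbours in \<open>W\<close> would be the
  centre of a blue fan; so red is 2-regular on \<open>W\<close>, and some vertex of \<open>Q\<close>, red to all but at most
  one vertex of \<open>W\<close>, is the centre of a red fan. It follows that there is no monochromatic \<open>K\<^sub>6\<close>
  (\<open>no_clique6\<close>), hence no vertex with eight neighbours in one colour (\<open>degree_le_7\<close>): every vertex
  has seven neighbours in one colour and six in the other. This in turn excludes a monochromatic
  \<open>K\<^sub>5\<close> (\<open>no_clique5\<close>). Now the only shape left for the red neighbourhood of a vertex \<open>v\<close> of red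
  degree seven is a vertex \<open>w\<close>, a blue triangle \<open>I\<close> and a red triangle \<open>T\<close>, with all edges between
  \<open>I\<close> and \<open>T\<close> blue (\<open>split7_exists\<close>). Every \<open>i\<close> in \<open>I\<close> again has red degree seven, and comparing
  the partitions of the red neighbourhoods of \<open>v\<close> and of \<open>i\<close> yields a red fan with centre \<open>w\<close>
  (\<open>degree_ne_7\<close>).

  Lower bound. Blow up the colouring of \<open>K\<^sub>5\<close> by two pentagons, replacing one vertex by a single
  vertex and the others by triples; the two triples that are red to the single vertex are red
  inside and the other two are blue inside. The thirteen vertices obtained contain no
  monochromatic fan (\<open>pentagon_colour_fan_free\<close>).
\<close>

section \<open>Graphs without three disjoint edges\<close>

definition has_matching3 :: "('a \<Rightarrow> 'a \<Rightarrow> bool) \<Rightarrow> 'a set \<Rightarrow> bool" where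
  "has_matching3 E A \<longleftrightarrow> (\<exists>a a' b b' c c'. distinct [a, a', b, b', c, c'] \<and>
     {a, a', b, b', c, c'} \<subseteq> A \<and> E a a' \<and> E b b' \<and> E c c')"

lemma has_matching3I:
  "\<lbrakk>E a a'; E b b'; E c c'; distinct [a, a', b, b', c, c'];
    a \<in> A; a' \<in> A; b \<in> A; b' \<in> A; c \<in> A; c' \<in> A\<rbrakk> \<Longrightarrow> has_matching3 E A"
  unfolding has_matching3_def by blast

definition two_cover :: "('a \<Rightarrow> 'a \<Rightarrow> bool) \<Rightarrow> 'a set \<Rightarrow> bool" where
  "two_cover E A \<longleftrightarrow> (\<exists>a b. \<forall>x\<in>A - {a, b}. \<forall>y\<in>A - {a, b}. \<not> E x y)"

definition vertex_and_triple :: "('a \<Rightarrow> 'a \<Rightarrow> bool) \<Rightarrow> 'a set \<Rightarrow> bool" where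
  "vertex_and_triple E A \<longleftrightarrow> (\<exists>w T. w \<in> A \<and> T \<subseteq> A \<and> w \<notin> T \<and> card T = 3 \<and>
     (\<forall>x\<in>A - {w}. \<forall>y\<in>A - {w}. E x y \<longrightarrow> x \<in> T \<and> y \<in> T))"

definition in_five :: "('a \<Rightarrow> 'a \<Rightarrow> bool) \<Rightarrow> 'a set \<Rightarrow> bool" where
  "in_five E A \<longleftrightarrow> (\<exists>C. C \<subseteq> A \<and> card C = 5 \<and> (\<forall>x\<in>A. \<forall>y\<in>A. E x y \<longrightarrow> x \<in> C \<and> y \<in> C))"

definition in_two_triples :: "('a \<Rightarrow> 'a \<Rightarrow> bool) \<Rightarrow> 'a set \<Rightarrow> bool" where
  "in_two_triples E A \<longleftrightarrow> (\<exists>S T. S \<subseteq> A \<and> T \<subseteq> A \<and> S \<inter> T = {} \<and> card S = 3 \<and> card T = 3 \<and>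
     (\<forall>x\<in>A. \<forall>y\<in>A. E x y \<longrightarrow> x \<in> S \<and> y \<in> S \<or> x \<in> T \<and> y \<in> T))"

text \<open>The Tutte-Berge formula for matching number at most two, proved by augmenting paths. Let
  \<open>a b\<close> and \<open>c d\<close> be two disjoint edges and \<open>U\<close> the set of the
  remaining vertices, which is independent. If both ends of \<open>a b\<close> had different neighbours
  in \<open>U\<close>, the path through \<open>a b\<close> would be augmenting; so either one end has no
  neighbour in \<open>U\<close> (it is \<open>free\<close>) or both ends see the same single vertex
  \<open>t\<close> of \<open>U\<close> and nothing else there (they are \<open>tied\<close> to
  \<open>t\<close>). The same holds for \<open>c d\<close>, and the three combinations are treated
  separately.\<close>

lemma no_matching3_cases:
  assumes sym: "\<And>x y. E x y \<longleftrightarrow> E y x" and irr: "\<And>x. \<not> E x x"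
    and none: "\<not> has_matching3 E A"
  shows "two_cover E A \<or> vertex_and_triple E A \<or> in_five E A \<or> in_two_triples E A"
    (is "?shape")
proof (cases "\<exists>a b c d. {a, b, c, d} \<subseteq> A \<and> distinct [a, b, c, d] \<and> E a b \<and> E c d")
  case False
  show ?thesis
  proof (cases "\<exists>a\<in>A. \<exists>b\<in>A. E a b")
    case True
    then obtain a b where ab: "a \<in> A" "b \<in> A" "E a b" by blast
    have "\<not> E x y" if "x \<in> A - {a, b}" "y \<in> A - {a, b}" for x y
      using False ab that irr by (metis DiffE bot_least distinct_length_2_or_more distinct_singleton
          insertCI insert_subset)
    then show ?thesis unfolding two_cover_def by blast
  qed (auto simp: two_cover_def)
next
  case True
  then obtain a b c d where abcd: "{a, b, c, d} \<subseteq> A" "distinct [a, b, c, d]" "E a b" "E c d"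
    by blast
  have no3: False if "E p p'" "E q q'" "E r r'" "distinct [p, p', q, q', r, r']"
      "{p, p', q, q', r, r'} \<subseteq> A" for p p' q q' r r'
    using none that has_matching3I[of E p p' q q' r r' A] by auto
  define U where "U = A - {a, b, c, d}"
  have U: "\<not> E u u'" if "u \<in> U" "u' \<in> U" for u u'
    using no3[of a b c d u u'] that abcd irr unfolding U_def by auto
  define free where "free = (\<lambda>x. \<forall>u\<in>U. \<not> E x u \<and> \<not> E u x)"
  define tied where "tied = (\<lambda>x y t. t \<in> U \<and> E x t \<and> E y t \<and>
    (\<forall>u\<in>U. E x u \<or> E u x \<or> E y u \<or> E u y \<longrightarrow> u = t))"
  have ends: "free x \<or> free y \<or> (\<exists>t. tied x y t)"
    if "{x, y, z, z'} = {a, b, c, d}" "distinct [x, y, z, z']" "E z z'" for x y z z'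
  proof (rule ccontr)
    have mem: "x \<in> A" "y \<in> A" "z \<in> A" "z' \<in> A" "x \<notin> U" "y \<notin> U" "z \<notin> U" "z' \<notin> U"
      using that(1) abcd(1) unfolding U_def by auto
    assume "\<not> ?thesis"
    then obtain u u' where u: "u \<in> U" "u' \<in> U" "E x u" "E y u'" "u \<noteq> u'"
      using sym unfolding free_def tied_def by metis
    have "u \<in> A" "u' \<in> A" using u unfolding U_def by auto
    then show False
      using no3[of x u y u' z z'] that(2,3) mem u by auto
  qed
  have A: "A = {a, b, c, d} \<union> U" using abcd(1) unfolding U_def by auto
  have within: "\<forall>p\<in>B. \<forall>q\<in>B. E p q \<longrightarrow> p \<in> C \<and> q \<in> C"
    if "\<And>p q. p \<in> B - C \<Longrightarrow> q \<in> B \<Longrightarrow> \<not> E p q" for B C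
    using that sym by blast
  have both_free: ?shape
    if eq: "{x, y, z, z'} = {a, b, c, d}" and dist: "distinct [x, y, z, z']"
      and e: "E x y" "E z z'" and fr: "free y" "free z'" for x y z z'
  proof (cases "E y z'")
    case False
    have Aq: "A = {x, y, z, z'} \<union> U" using A eq by simp
    have "\<not> E z' y" using False sym by blast
    then have "\<not> E p q" if "p \<in> {y, z'} \<union> U" "q \<in> {y, z'} \<union> U" for p q
      using fr False U irr that unfolding free_def by auto
    then have "\<forall>p\<in>A - {x, z}. \<forall>q\<in>A - {x, z}. \<not> E p q"
      unfolding Aq by blast
    then show ?thesis unfolding two_cover_def by blast
  next
    case yz: True
    have Aq: "A = {x, y, z, z'} \<union> U" using A eq by simp
    have disj: "x \<notin> U" "y \<notin> U" "z \<notin> U" "z' \<notin> U" using eq unfolding U_def by auto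
    have one: "u = u'" if "u \<in> U" "u' \<in> U" "E x u" "E z u'" for u u'
      using no3[of x u y z' z u'] yz that dist disj unfolding Aq by auto
    consider "free x" | "free z" | t where "t \<in> U"
        "\<forall>u\<in>U. E x u \<or> E u x \<or> E z u \<or> E u z \<longrightarrow> u = t"
      unfolding free_def using one sym by metis
    then show ?thesis
    proof cases
      case 1
      have "\<not> E p q" if "p \<in> A - {z} - {x, y, z'}" "q \<in> A - {z}" for p q
        using fr 1 U that unfolding Aq free_def by auto
      then have "\<forall>p\<in>A - {z}. \<forall>q\<in>A - {z}. E p q \<longrightarrow> p \<in> {x, y, z'} \<and> q \<in> {x, y, z'}"
        by (rule within)
      moreover have "card {x, y, z'} = 3" "z \<notin> {x, y, z'}" using dist by auto
      ultimately have "vertex_and_triple E A"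
        unfolding vertex_and_triple_def Aq by (intro exI[of _ z] exI[of _ "{x, y, z'}"]) auto
      then show ?thesis by blast
    next
      case 2
      have "\<not> E p q" if "p \<in> A - {x} - {y, z, z'}" "q \<in> A - {x}" for p q
        using fr 2 U that unfolding Aq free_def by auto
      then have "\<forall>p\<in>A - {x}. \<forall>q\<in>A - {x}. E p q \<longrightarrow> p \<in> {y, z, z'} \<and> q \<in> {y, z, z'}"
        by (rule within)
      moreover have "card {y, z, z'} = 3" "x \<notin> {y, z, z'}" using dist by auto
      ultimately have "vertex_and_triple E A"
        unfolding vertex_and_triple_def Aq by (intro exI[of _ x] exI[of _ "{y, z, z'}"]) auto
      then show ?thesis by blast
    next
      case 3
      have "\<not> E p q" if "p \<in> A - {x, y, z, z', t}" "q \<in> A" for p q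
      proof -
        have p: "p \<in> U" "p \<noteq> t" using that unfolding Aq by auto
        have "\<not> E p x" "\<not> E p y" "\<not> E p z" "\<not> E p z'"
          using p fr 3 unfolding free_def by blast+
        then show ?thesis using p U that(2) unfolding Aq by auto
      qed
      then have "\<forall>p\<in>A. \<forall>q\<in>A. E p q \<longrightarrow> p \<in> {x, y, z, z', t} \<and> q \<in> {x, y, z, z', t}"
        by (rule within)
      moreover have "t \<notin> {x, y, z, z'}" using 3(1) disj by blast
      then have "card {x, y, z, z', t} = 5" using dist by auto
      ultimately have "in_five E A"
        unfolding in_five_def Aq using 3(1) by (intro exI[of _ "{x, y, z, z', t}"]) auto
      then show ?thesis by blast
    qed
  qed
  have one_tied: ?shape
    if eq: "{x, y, z, z'} = {a, b, c, d}" and dist: "distinct [x, y, z, z']"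
      and e: "E x y" "E z z'" and ti: "tied x y t" and fr: "free z'" for x y z z' t
  proof -
    have Aq: "A = {x, y, z, z'} \<union> U" using A eq by simp
    have disj: "x \<notin> U" "y \<notin> U" "z \<notin> U" "z' \<notin> U" using eq unfolding U_def by auto
    have t: "t \<in> U" "E x t" "E y t"
      "\<forall>u\<in>U. E x u \<or> E u x \<or> E y u \<or> E u y \<longrightarrow> u = t"
      using ti unfolding tied_def by auto
    show ?thesis
    proof (cases "\<exists>u\<in>U. E z u \<and> u \<noteq> t")
      case True
      then obtain u where u: "u \<in> U" "E z u" "u \<noteq> t" by blast
      have "\<not> E x z'" "\<not> E y z'"
      proof -
        have "distinct [x, y, z, z', t, u]" using dist disj t(1) u(1,3) by auto
        moreover have "{x, y, z, z', t, u} \<subseteq> A" using t(1) u(1) unfolding Aq by auto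
        ultimately show "\<not> E x z'" "\<not> E y z'"
          using no3[of x z' y t z u] no3[of y z' x t z u] t(2,3) u(2) by auto
      qed
      then have zxy: "\<not> E z' x" "\<not> E z' y" using sym by blast+
      have "\<not> E p q" if "p \<in> A - {z} - {x, y, t}" "q \<in> A - {z}" for p q
      proof -
        have p: "p = z' \<or> p \<in> U \<and> p \<noteq> t" using that unfolding Aq by auto
        have "\<not> E p x" "\<not> E p y" "\<not> E p z'"
          using p zxy fr irr t(4) unfolding free_def by blast+
        moreover have "\<forall>u\<in>U. \<not> E p u" using p fr U unfolding free_def by blast
        ultimately show ?thesis using that(2) unfolding Aq by auto
      qed
      then have "\<forall>p\<in>A - {z}. \<forall>q\<in>A - {z}. E p q \<longrightarrow> p \<in> {x, y, t} \<and> q \<in> {x, y, t}"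
        by (rule within)
      moreover have "t \<notin> {x, y, z, z'}" using t(1) disj by blast
      then have "card {x, y, t} = 3" "z \<notin> {x, y, t}" using dist by auto
      ultimately have "vertex_and_triple E A"
        unfolding vertex_and_triple_def Aq using t(1)
        by (intro exI[of _ z] exI[of _ "{x, y, t}"]) auto
      then show ?thesis by blast
    next
      case False
      then have "\<forall>u\<in>U. E u z \<longrightarrow> u = t" using sym by blast
      then have "\<not> E p q" if "p \<in> A - {x, y, z, z', t}" "q \<in> A" for p q
      proof -
        have p: "p \<in> U" "p \<noteq> t" using that unfolding Aq by auto
        have "\<not> E p x" "\<not> E p y" "\<not> E p z" "\<not> E p z'"
          using p fr t \<open>\<forall>u\<in>U. E u z \<longrightarrow> u = t\<close> unfolding free_def by blast+
        then show ?thesis using p U that(2) unfolding Aq by auto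
      qed
      then have "\<forall>p\<in>A. \<forall>q\<in>A. E p q \<longrightarrow> p \<in> {x, y, z, z', t} \<and> q \<in> {x, y, z, z', t}"
        by (rule within)
      moreover have "t \<notin> {x, y, z, z'}" using t(1) disj by blast
      then have "card {x, y, z, z', t} = 5" using dist by auto
      ultimately have "in_five E A"
        unfolding in_five_def Aq using t(1) by (intro exI[of _ "{x, y, z, z', t}"]) auto
      then show ?thesis by blast
    qed
  qed
  have both_tied: ?shape if s: "tied a b s" and t: "tied c d t" for s t
  proof (cases "s = t")
    case True
    have "\<not> E p q" if "p \<in> A - {a, b, c, d, t}" "q \<in> A" for p q
    proof -
      have p: "p \<in> U" "p \<noteq> t" using that unfolding A by auto
      have "\<not> E p a" "\<not> E p b" "\<not> E p c" "\<not> E p d"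
        using p s t True unfolding tied_def by blast+
      then show ?thesis using p U that(2) unfolding A by auto
    qed
    then have "\<forall>p\<in>A. \<forall>q\<in>A. E p q \<longrightarrow> p \<in> {a, b, c, d, t} \<and> q \<in> {a, b, c, d, t}"
      by (rule within)
    moreover have tU: "t \<in> U" using t unfolding tied_def by blast
    then have "card {a, b, c, d, t} = 5" using abcd(2) unfolding U_def by auto
    ultimately have "in_five E A"
      unfolding in_five_def using abcd(1) tU unfolding U_def
      by (intro exI[of _ "{a, b, c, d, t}"]) auto
    then show ?thesis by blast
  next
    case False
    have st: "s \<in> U" "E a s" "E b s" "\<forall>u\<in>U. E a u \<or> E u a \<or> E b u \<or> E u b \<longrightarrow> u = s"
      "t \<in> U" "E c t" "E d t" "\<forall>u\<in>U. E c u \<or> E u c \<or> E d u \<or> E u d \<longrightarrow> u = t"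
      using s t unfolding tied_def by auto
    have "\<not> E a c" "\<not> E a d" "\<not> E b c" "\<not> E b d"
      using no3[of a c b s d t] no3[of a d b s c t] no3[of b c a s d t] no3[of b d a s c t]
        st(1-3,5-7) abcd False unfolding U_def by auto
    then have dc: "\<not> E c a" "\<not> E d a" "\<not> E c b" "\<not> E d b" using sym by blast+
    have cross: "\<not> E p q \<and> \<not> E q p" if "p \<in> {a, b, s}" "q \<in> A - {a, b, s}" for p q
    proof (cases "q \<in> U")
      case True
      then have "q \<noteq> s" using that(2) by simp
      then have "\<not> E a q \<and> \<not> E q a \<and> \<not> E b q \<and> \<not> E q b" using True st(4) by blast
      moreover have "\<not> E s q \<and> \<not> E q s" using True st(1) U by blast
      ultimately show ?thesis using that(1) by auto
    next
      case False
      then have "q \<in> {c, d}" using that(2) unfolding A by auto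
      moreover have "\<not> E c s \<and> \<not> E s c \<and> \<not> E d s \<and> \<not> E s d"
        using st(1,8) \<open>s \<noteq> t\<close> by blast
      ultimately have "\<forall>p\<in>{a, b, s}. \<forall>q\<in>{c, d}. \<not> E p q \<and> \<not> E q p"
        using dc \<open>\<not> E a c\<close> \<open>\<not> E a d\<close> \<open>\<not> E b c\<close> \<open>\<not> E b d\<close> by simp
      then show ?thesis using that(1) \<open>q \<in> {c, d}\<close> by blast
    qed
    have rest: "\<not> E p q" if "p \<in> A - {a, b, s} - {c, d, t}" "q \<in> A - {a, b, s}" for p q
    proof -
      have p: "p \<in> U" "p \<noteq> t" using that unfolding A by auto
      have "\<not> E p c" "\<not> E p d" using p st(8) by blast+
      moreover have "\<forall>u\<in>U. \<not> E p u" using p U by blast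
      ultimately show ?thesis using that(2) unfolding A by auto
    qed
    have "\<forall>p\<in>A - {a, b, s}. \<forall>q\<in>A - {a, b, s}. E p q \<longrightarrow> p \<in> {c, d, t} \<and> q \<in> {c, d, t}"
      using rest by (rule within)
    then have "\<forall>x\<in>A. \<forall>y\<in>A. E x y \<longrightarrow> x \<in> {a, b, s} \<and> y \<in> {a, b, s} \<or> x \<in> {c, d, t} \<and> y \<in> {c, d, t}"
      using cross by blast
    moreover have "card {a, b, s} = 3" "card {c, d, t} = 3" "{a, b, s} \<inter> {c, d, t} = {}"
      using st(1,5) abcd(2) False unfolding U_def by auto
    ultimately have "in_two_triples E A"
      unfolding in_two_triples_def using abcd(1) st(1,5) unfolding U_def
      by (intro exI[of _ "{a, b, s}"] exI[of _ "{c, d, t}"]) auto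
    then show ?thesis by blast
  qed
  have e: "E b a" "E d c" using abcd sym by auto
  consider "free b \<or> free a" "free d \<or> free c" | s where "tied a b s" "free d \<or> free c"
    | t where "free b \<or> free a" "tied c d t" | s t where "tied a b s" "tied c d t"
    using ends[of a b c d] ends[of c d a b] abcd(2-4) by (auto simp: insert_commute)
  then show ?thesis
  proof cases
    case 1
    then show ?thesis
      using both_free[of a b c d] both_free[of b a c d] both_free[of a b d c] both_free[of b a d c]
        abcd(2-4) e by (auto simp: insert_commute)
  next
    case 2
    then show ?thesis
      using one_tied[of a b c d s] one_tied[of a b d c s] abcd(2-4) e
      by (auto simp: insert_commute)
  next
    case 3
    then show ?thesis
      using one_tied[of c d a b t] one_tied[of c d b a t] abcd(2-4) e
      by (auto simp: insert_commute)
  next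
    case 4
    then show ?thesis by (rule both_tied)
  qed
qed

text \<open>A weak form of Dirac's theorem: a graph on six vertices of minimum degree three has a
  perfect matching. Each of the four shapes leaves, among at least six vertices, one of degree at most
  two.\<close>

lemma ex_degree_le_2:
  assumes sym: "\<And>x y. E x y \<longleftrightarrow> E y x" and irr: "\<And>x. \<not> E x x"
    and none: "\<not> has_matching3 E A" and fin: "finite A" and card: "card A \<ge> 6"
  shows "\<exists>x\<in>A. card {y\<in>A. E x y} \<le> 2"
proof -
  have outside: "\<exists>x\<in>A. x \<notin> S" if "card S \<le> 5" "finite S" for S
    using that card fin by (metis card_mono linorder_not_less order.trans subsetI numeral_le_iff
        semiring_norm(68) semiring_norm(71) semiring_norm(73) semiring_norm(72) Suc_n_not_le_n
        eval_nat_numeral(3))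
  have le: "card {y\<in>A. E x y} \<le> card S" if "{y\<in>A. E x y} \<subseteq> S" "finite S" for x S
    using that by (rule card_mono[rotated])
  from no_matching3_cases[OF sym irr none] consider
    "two_cover E A" | "vertex_and_triple E A" | "in_five E A" | "in_two_triples E A" by blast
  then show ?thesis
  proof cases
    case 1
    then obtain a b where ab: "\<forall>x\<in>A - {a, b}. \<forall>y\<in>A - {a, b}. \<not> E x y"
      unfolding two_cover_def by blast
    have c2: "card {a, b} \<le> 2" by (simp add: card_insert_if)
    obtain x where x: "x \<in> A" "x \<notin> {a, b}" using outside[of "{a, b}"] c2 by auto
    then have "card {y\<in>A. E x y} \<le> card {a, b}" using ab by (intro le) auto
    then show ?thesis using c2 x by (meson order_trans)
  next
    case 2
    then obtain w T where wT: "card T = 3" "\<forall>x\<in>A - {w}. \<forall>y\<in>A - {w}. E x y \<longrightarrow> x \<in> T \<and> y \<in> T"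
      unfolding vertex_and_triple_def by blast
    have fT: "finite T" using wT by (metis card.infinite zero_neq_numeral)
    have "card (insert w T) \<le> 5" using wT fT by (simp add: card_insert_if)
    then obtain x where x: "x \<in> A" "x \<notin> insert w T"
      using outside[of "insert w T"] fT by blast
    then have "card {y\<in>A. E x y} \<le> card {w}" using wT by (intro le) auto
    then show ?thesis using x by (intro bexI[of _ x]) auto
  next
    case 3
    then obtain C where C: "card C = 5" "\<forall>x\<in>A. \<forall>y\<in>A. E x y \<longrightarrow> x \<in> C \<and> y \<in> C"
      unfolding in_five_def by blast
    have fC: "finite C" using C by (metis card.infinite zero_neq_numeral)
    obtain x where x: "x \<in> A" "x \<notin> C" using outside[of C] C fC by auto
    then have "{y\<in>A. E x y} = {}" using C by blast
    then have "card {y\<in>A. E x y} = 0" by (simp only: card.empty)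
    then show ?thesis using x(1) by (metis zero_le)
  next
    case 4
    then obtain S T where ST: "S \<inter> T = {}" "card S = 3" "card T = 3"
      "\<forall>x\<in>A. \<forall>y\<in>A. E x y \<longrightarrow> x \<in> S \<and> y \<in> S \<or> x \<in> T \<and> y \<in> T"
      unfolding in_two_triples_def by blast
    have fin': "finite S" "finite T" using ST by (metis card.infinite zero_neq_numeral)+
    obtain x where x: "x \<in> A" "x \<notin> S" using outside[of S] ST fin' by auto
    have "card {y\<in>A. E x y} \<le> card (T - {x})"
      using ST x irr fin' by (intro le) auto
    show ?thesis
    proof (cases "x \<in> T")
      case True
      then show ?thesis using \<open>card {y\<in>A. E x y} \<le> card (T - {x})\<close> ST fin' x by auto
    next
      case False
      then have "{y\<in>A. E x y} = {}" using ST x by blast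
      then have "card {y\<in>A. E x y} = 0" by (simp only: card.empty)
      then show ?thesis using x(1) by (metis zero_le)
    qed
  qed
qed

lemma card_ge_2_elems:
  assumes "card S \<ge> 2" shows "\<exists>a b. {a, b} \<subseteq> S \<and> a \<noteq> b"
proof -
  obtain T where "T \<subseteq> S" "card T = 2" using assms by (metis obtain_subset_with_card_n)
  then show ?thesis by (auto simp: card_2_iff)
qed

lemma card_split: "finite S \<Longrightarrow> card {y\<in>S. P y} + card {y\<in>S. \<not> P y} = card S"
proof -
  assume "finite S"
  then have "card ({y\<in>S. P y} \<union> {y\<in>S. \<not> P y}) = card {y\<in>S. P y} + card {y\<in>S. \<not> P y}"
    by (intro card_Un_disjoint) auto
  moreover have "{y\<in>S. P y} \<union> {y\<in>S. \<not> P y} = S" by auto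
  ultimately show ?thesis by simp
qed

text \<open>Fix an edge \<open>w a\<close>. If no edge is disjoint from it, every other vertex is
  adjacent to both \<open>w\<close> and \<open>a\<close>, and any two others, one joined to
  \<open>w\<close> and one to \<open>a\<close>, give disjoint edges.\<close>

lemma two_disjoint_edges:
  assumes sym: "\<And>x y. E x y \<longleftrightarrow> E y x" and irr: "\<And>x. \<not> E x x"
    and W: "finite W" "card W \<ge> 4" and deg: "\<And>w. w \<in> W \<Longrightarrow> card {y\<in>W. E w y} \<ge> 2"
  shows "\<exists>a a' b b'. {a, a', b, b'} \<subseteq> W \<and> distinct [a, a', b, b'] \<and> E a a' \<and> E b b'"
proof -
  have another: "\<exists>y\<in>W. E w y \<and> y \<noteq> z" if "w \<in> W" for w z
  proof -
    have "\<not> {y\<in>W. E w y} \<subseteq> {z}" using deg[OF that] card_mono[of "{z}" "{y\<in>W. E w y}"] by auto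
    then show ?thesis by blast
  qed
  obtain w where w: "w \<in> W" using W by fastforce
  obtain a where a: "a \<in> W" "E w a" using another[OF w] by blast
  have "w \<noteq> a" using a irr by auto
  then have "card (W - {w, a}) \<ge> 2" using w a W by (simp add: card_Diff_subset)
  then obtain r s where rs: "r \<in> W - {w, a}" "s \<in> W - {w, a}" "r \<noteq> s"
    using card_ge_2_elems[of "W - {w, a}"] by auto
  show ?thesis
  proof (cases "\<exists>p\<in>W - {w, a}. \<exists>q\<in>W - {w, a}. E p q")
    case True
    then obtain p q where "p \<in> W - {w, a}" "q \<in> W - {w, a}" "E p q" by blast
    then show ?thesis using w a irr \<open>w \<noteq> a\<close> by (intro exI[of _ w] exI[of _ a] exI[of _ p] exI[of _ q]) auto
  next
    case False
    have "E r w" using another[of r a] rs(1) False by blast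
    moreover have "E s a" using another[of s w] rs(2) False by blast
    ultimately show ?thesis using w a rs \<open>w \<noteq> a\<close>
      by (intro exI[of _ r] exI[of _ w] exI[of _ s] exI[of _ a]) auto
  qed
qed

section \<open>Colourings without a monochromatic fan\<close>

definition adj :: "('a \<Rightarrow> 'a \<Rightarrow> bool) \<Rightarrow> bool \<Rightarrow> 'a \<Rightarrow> 'a \<Rightarrow> bool" where
  "adj f c x y \<longleftrightarrow> x \<noteq> y \<and> f x y = c"

definition nbh :: "'a set \<Rightarrow> ('a \<Rightarrow> 'a \<Rightarrow> bool) \<Rightarrow> bool \<Rightarrow> 'a \<Rightarrow> 'a set" where
  "nbh V f c v = {x \<in> V. adj f c v x}"

definition clique :: "('a \<Rightarrow> 'a \<Rightarrow> bool) \<Rightarrow> bool \<Rightarrow> 'a set \<Rightarrow> bool" where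
  "clique f c K \<longleftrightarrow> (\<forall>x\<in>K. \<forall>y\<in>K. x \<noteq> y \<longrightarrow> adj f c x y)"

lemma adj_other: "x \<noteq> y \<Longrightarrow> adj f (\<not> c) x y \<longleftrightarrow> \<not> adj f c x y"
  unfolding adj_def by auto

lemma card_ge_3_elems:
  assumes "card S \<ge> 3" shows "\<exists>a b c. {a, b, c} \<subseteq> S \<and> distinct [a, b, c]"
proof -
  obtain T where "T \<subseteq> S" "card T = 3" using assms by (metis obtain_subset_with_card_n)
  then show ?thesis by (auto simp: card_3_iff)
qed

lemma card_eq_4_elems:
  assumes "card S = 4" shows "\<exists>a b c d. S = {a, b, c, d} \<and> distinct [a, b, c, d]"
  using assms by (auto simp: card_Suc_eq numeral_eq_Suc)

text \<open>A greedy system of distinct representatives: this is how the blades of a fan between two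
  vertex sets are chosen.\<close>

lemma sdr3:
  assumes "card X1 \<ge> 1" "card X2 \<ge> 2" "card X3 \<ge> 3"
  shows "\<exists>x1\<in>X1. \<exists>x2\<in>X2. \<exists>x3\<in>X3. distinct [x1, x2, x3]"
proof -
  obtain x1 where x1: "x1 \<in> X1" using assms(1) by fastforce
  have "\<not> X2 \<subseteq> {x1}" using assms(2) card_mono[of "{x1}" X2] by auto
  then obtain x2 where x2: "x2 \<in> X2" "x2 \<noteq> x1" by auto
  have "\<not> X3 \<subseteq> {x1, x2}" using assms(3) card_mono[of "{x1, x2}" X3] x2 by auto
  then obtain x3 where "x3 \<in> X3" "x3 \<noteq> x1" "x3 \<noteq> x2" by auto
  then have "distinct [x1, x2, x3]" using x2 by auto
  then show ?thesis using x1 x2(1) \<open>x3 \<in> X3\<close> by blast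
qed

text \<open>A colour class is named by a truth value, so that \<open>\<not> c\<close> is the colour
  other than \<open>c\<close>.\<close>

locale fan_free_14 =
  fixes V :: "'a set" and f :: "'a \<Rightarrow> 'a \<Rightarrow> bool"
  assumes fin: "finite V" and card14: "card V = 14"
    and sym: "f x y = f y x"
    and no_fan: "v \<in> V \<Longrightarrow> \<not> has_matching3 (adj f c) (nbh V f c v)"
begin

abbreviation "E \<equiv> adj f"
abbreviation "N \<equiv> nbh V f"

lemma E_sym: "E c x y \<longleftrightarrow> E c y x"
  unfolding adj_def using sym by auto

lemma E_irrefl: "\<not> E c x x"
  unfolding adj_def by simp

lemma fanD:
  assumes "distinct [v, a, a', b, b', d, d']" "{v, a, a', b, b', d, d'} \<subseteq> V"
    and "E c v a" "E c v a'" "E c v b" "E c v b'" "E c v d" "E c v d'"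
    and "E c a a'" "E c b b'" "E c d d'"
  shows False
proof -
  have "has_matching3 (E c) (N c v)"
    using assms by (intro has_matching3I[of "E c" a a' b b' d d']) (auto simp: nbh_def)
  then show False using no_fan assms(2) by auto
qed

lemma nbh_cases:
  assumes "v \<in> V" "A \<subseteq> N c v"
  shows "two_cover (E c) A \<or> vertex_and_triple (E c) A \<or> in_five (E c) A \<or> in_two_triples (E c) A"
proof -
  have "\<not> has_matching3 (E c) A"
    using no_fan[OF assms(1), of c] assms(2) unfolding has_matching3_def by (meson order_trans)
  then show ?thesis using no_matching3_cases[of "E c" A] E_sym E_irrefl by blast
qed

lemma N_sub: "N c v \<subseteq> V" unfolding nbh_def by auto

lemma fin_sub: "S \<subseteq> V \<Longrightarrow> finite S" using fin finite_subset by blast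

lemma card_nbrs:
  assumes "W \<subseteq> V" "w \<in> W"
  shows "card {y\<in>W. E c w y} + card {y\<in>W. E (\<not> c) w y} + 1 = card W"
proof -
  have fW: "finite W" using assms fin_sub by auto
  have "{y\<in>W. E c w y} = {y\<in>W - {w}. E c w y}" "{y\<in>W. E (\<not> c) w y} = {y\<in>W - {w}. \<not> E c w y}"
    by (auto simp: adj_def)
  then have "card {y\<in>W. E c w y} + card {y\<in>W. E (\<not> c) w y} = card (W - {w})"
    using card_split[of "W - {w}" "E c w"] fW by simp
  then show ?thesis using fW assms by (metis Suc_eq_plus1 card_Suc_Diff1)
qed

lemma degree_sum:
  assumes "v \<in> V" shows "card (N c v) + card (N (\<not> c) v) = 13"
  using card_nbrs[of V v c] assms card14 unfolding nbh_def by simp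

text \<open>Call \<open>c\<close> blue and the other colour red. If \<open>w\<close> had three red
  neighbours \<open>y\<close> in \<open>W\<close>, at least three vertices of \<open>Q\<close> would be
  red to both \<open>w\<close> and \<open>y\<close>, for each of the three, because \<open>w\<close> and
  \<open>y\<close> have at most one blue neighbour each among the five. Choosing distinct ones makes a
  red fan with centre \<open>w\<close>.\<close>

lemma few_nbrs_of_opposite_colour:
  assumes Q: "Q \<subseteq> V" "card Q = 5" and W: "W \<subseteq> V" "Q \<inter> W = {}"
    and few: "\<And>w. w \<in> W \<Longrightarrow> card {q\<in>Q. E c w q} \<le> 1"
    and w: "w \<in> W"
  shows "card {y\<in>W. E (\<not> c) w y} \<le> 2"
proof (rule ccontr)
  assume "\<not> ?thesis"
  then have "card {y\<in>W. E (\<not> c) w y} \<ge> 3" by simp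
  then obtain y1 y2 y3 where y: "{y1, y2, y3} \<subseteq> {y\<in>W. E (\<not> c) w y}" "distinct [y1, y2, y3]"
    using card_ge_3_elems by metis
  define X where "X = (\<lambda>y. Q - ({q\<in>Q. E c w q} \<union> {q\<in>Q. E c y q}))"
  have X: "card (X y) \<ge> 3" if "y \<in> W" for y
  proof -
    have "card ({q\<in>Q. E c w q} \<union> {q\<in>Q. E c y q}) \<le> 2"
      using card_Un_le[of "{q\<in>Q. E c w q}" "{q\<in>Q. E c y q}"] few[OF w] few[OF that] by linarith
    moreover have "finite ({q\<in>Q. E c w q} \<union> {q\<in>Q. E c y q})" using Q(1) fin_sub by auto
    ultimately show ?thesis
      using diff_card_le_card_Diff[of "{q\<in>Q. E c w q} \<union> {q\<in>Q. E c y q}" Q] Q(2)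
      unfolding X_def by linarith
  qed
  have "y1 \<in> W" "y2 \<in> W" "y3 \<in> W" using y by auto
  then have "card (X y1) \<ge> 1" "card (X y2) \<ge> 2" "card (X y3) \<ge> 3" using X[of y1] X[of y2] X[of y3] by auto
  then obtain q1 q2 q3 where q: "q1 \<in> X y1" "q2 \<in> X y2" "q3 \<in> X y3" "distinct [q1, q2, q3]"
    using sdr3 by meson
  have qQ: "q1 \<in> Q" "q2 \<in> Q" "q3 \<in> Q" using q unfolding X_def by auto
  have "{w, y1, y2, y3} \<subseteq> W" using w y(1) by auto
  then have ne: "{q1, q2, q3} \<inter> {w, y1, y2, y3} = {}" using qQ W(2) by blast
  have yw: "w \<noteq> y1" "w \<noteq> y2" "w \<noteq> y3" using y(1) unfolding adj_def by auto
  show False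
  proof (rule fanD[of w y1 q1 y2 q2 y3 q3 "\<not> c"])
    show "distinct [w, y1, q1, y2, q2, y3, q3]"
      using y(2) q(4) ne yw by auto
    show "{w, y1, q1, y2, q2, y3, q3} \<subseteq> V" using y qQ w Q W by auto
    show "E (\<not> c) w y1" "E (\<not> c) w y2" "E (\<not> c) w y3" using y(1) by auto
    show "E (\<not> c) w q1" "E (\<not> c) w q2" "E (\<not> c) w q3"
      "E (\<not> c) y1 q1" "E (\<not> c) y2 q2" "E (\<not> c) y3 q3"
      using q(1-3) ne unfolding X_def by (auto simp: adj_other)
  qed
qed

section \<open>Large cliques and large degrees\<close>


text \<open>Call \<open>c\<close> blue and the other colour red. Red is 2-regular on \<open>W\<close>:
  red degree at least three gives a red fan, red degree at most one leaves six blue neighbours inducing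
  a blue graph of minimum degree three. As each vertex of \<open>W\<close> has at most one blue
  neighbour in \<open>Q\<close>, the five blue neighbourhoods in \<open>W\<close> of the vertices of
  \<open>Q\<close> have total size at most eight, so some \<open>q\<close> in \<open>Q\<close> is red to
  at least seven vertices of \<open>W\<close>. A 2-regular graph on eight vertices still has three
  disjoint edges after deletion of one vertex.\<close>

lemma no_sparse_5_8:
  assumes Q: "Q \<subseteq> V" "card Q = 5" and W: "W \<subseteq> V" "Q \<inter> W = {}" "card W = 8"
    and few: "\<And>w. w \<in> W \<Longrightarrow> card {q\<in>Q. E c w q} \<le> 1"
  shows False
proof -
  have finW: "finite W" and finQ: "finite Q" using W Q fin_sub by auto
  have red_le: "card {y\<in>W. E (\<not> c) w y} \<le> 2" if "w \<in> W" for w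
    using few_nbrs_of_opposite_colour[OF Q W(1,2) few that] .
  have blue_le: "card {y\<in>W. E c w y} \<le> 5" if w: "w \<in> W" for w
  proof (rule ccontr)
    assume "\<not> ?thesis"
    then have "6 \<le> card {y\<in>W. E c w y}" by simp
    then obtain M where M: "M \<subseteq> {y\<in>W. E c w y}" "card M = 6" "finite M"
      by (metis obtain_subset_with_card_n)
    have "M \<subseteq> N c w" using M W unfolding nbh_def by auto
    then have "\<not> has_matching3 (E c) M"
      using no_fan[of w c] w W unfolding has_matching3_def by (meson order_trans subsetD)
    then obtain x where x: "x \<in> M" "card {y\<in>M. E c x y} \<le> 2"
      using ex_degree_le_2[of "E c" M] M E_sym E_irrefl by (metis order_refl)
    have "M \<subseteq> W" using M by auto
    then have "card {y\<in>M. E c x y} + card {y\<in>M. E (\<not> c) x y} + 1 = 6"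
      using card_nbrs[of M x c] x M W by (metis order_trans)
    moreover have "card {y\<in>M. E (\<not> c) x y} \<le> card {y\<in>W. E (\<not> c) x y}"
      using \<open>M \<subseteq> W\<close> finW by (intro card_mono) auto
    moreover have "card {y\<in>W. E (\<not> c) x y} \<le> 2" using red_le x \<open>M \<subseteq> W\<close> by auto
    ultimately show False using x by linarith
  qed
  have red: "card {y\<in>W. E (\<not> c) w y} = 2" if "w \<in> W" for w
    using card_nbrs[of W w c] red_le[of w] blue_le[of w] that W by auto
  \<comment> \<open>Hall's condition in a regular graph: edges counted from \<open>X\<close> and from
    \<open>Z\<close>. It contradicts the first three shapes, which leave too many vertices
    with too few possible neighbours.\<close>
  have expand: "card X \<le> card Z"
    if XZ: "X \<subseteq> W" "Z \<subseteq> W" and nb: "\<And>x y. x \<in> X \<Longrightarrow> y \<in> W \<Longrightarrow> E (\<not> c) x y \<Longrightarrow> y \<in> Z" for X Z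
  proof -
    have fXZ: "finite X" "finite Z" using XZ finW finite_subset by auto
    have "2 * card X = (\<Sum>x\<in>X. card {y\<in>W. E (\<not> c) x y})"
      using red XZ by (simp add: subset_iff)
    also have "\<dots> = (\<Sum>x\<in>X. card {z\<in>Z. E (\<not> c) x z})"
      using nb XZ by (intro sum.cong arg_cong[where f = card]) auto
    also have "\<dots> = (\<Sum>z\<in>Z. card {x\<in>X. E (\<not> c) x z})"
      unfolding card_eq_sum using fXZ by (intro sum.swap_restrict)
    also have "\<dots> \<le> (\<Sum>z\<in>Z. 2)"
    proof (rule sum_mono)
      fix z assume "z \<in> Z"
      have "card {x\<in>X. E (\<not> c) x z} \<le> card {y\<in>W. E (\<not> c) z y}"
        using XZ finW E_sym by (intro card_mono) auto
      then show "card {x\<in>X. E (\<not> c) x z} \<le> 2" using red XZ \<open>z \<in> Z\<close> by auto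
    qed
    finally show ?thesis by simp
  qed
  have "(\<Sum>q\<in>Q. card {w\<in>W. E c w q}) = (\<Sum>w\<in>W. card {q\<in>Q. E c w q})"
    unfolding card_eq_sum using finQ finW by (intro sum.swap_restrict)
  also have "\<dots> \<le> (\<Sum>w\<in>W. 1)" using few by (intro sum_mono) auto
  finally have "(\<Sum>q\<in>Q. card {w\<in>W. E c w q}) \<le> 8" using W by simp
  moreover have "(\<Sum>q\<in>Q. card {w\<in>W. E c w q}) \<ge> (\<Sum>q\<in>Q. 2)"
    if "\<forall>q\<in>Q. card {w\<in>W. E c w q} \<ge> 2" using that by (intro sum_mono) auto
  ultimately obtain q where q: "q \<in> Q" "card {w\<in>W. E c w q} \<le> 1"
    using Q(2) by fastforce
  define M where "M = {w\<in>W. \<not> E c w q}"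
  define R where "R = {w\<in>W. E c w q}"
  have MR: "card R + card M = 8" "M \<subseteq> W" "R \<subseteq> W" "W = R \<union> M" "M \<inter> R = {}"
    using card_split[OF finW, of "\<lambda>w. E c w q"] W unfolding M_def R_def by auto
  have R1: "card R \<le> 1" using q unfolding R_def by simp
  have finM: "finite M" "finite R" using MR finW finite_subset by auto
  have "M \<subseteq> N (\<not> c) q"
    using q(1) W sym unfolding M_def nbh_def adj_def by auto
  then consider "two_cover (E (\<not> c)) M" | "vertex_and_triple (E (\<not> c)) M"
    | "in_five (E (\<not> c)) M" | "in_two_triples (E (\<not> c)) M"
    using nbh_cases[of q M "\<not> c"] q Q by blast
  then show False
  proof cases
    case 1
    then obtain a b where ab: "\<forall>x\<in>M - {a, b}. \<forall>y\<in>M - {a, b}. \<not> E (\<not> c) x y"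
      unfolding two_cover_def by blast
    have "card (M - {a, b}) \<le> card (R \<union> ({a, b} \<inter> W))"
      using MR ab by (intro expand) auto
    also have "\<dots> \<le> card R + card ({a, b} \<inter> W)" by (rule card_Un_le)
    also have "card ({a, b} \<inter> W) \<le> card {a, b}" by (intro card_mono) auto
    also have "card {a, b} \<le> 2" by (simp add: card_insert_if)
    finally have "card (M - {a, b}) \<le> card R + 2" by simp
    moreover have "card M \<le> card (M - {a, b}) + 2"
      using diff_card_le_card_Diff[of "{a, b}" M] \<open>card {a, b} \<le> 2\<close> by simp
    ultimately show False using MR(1) R1 by linarith
  next
    case 2
    then obtain w T where wT: "w \<in> M" "T \<subseteq> M" "w \<notin> T" "card T = 3"
      "\<forall>x\<in>M - {w}. \<forall>y\<in>M - {w}. E (\<not> c) x y \<longrightarrow> x \<in> T \<and> y \<in> T"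
      unfolding vertex_and_triple_def by blast
    have "card (M - insert w T) \<le> card (insert w R)"
      using MR wT by (intro expand) auto
    moreover have "finite T" using wT(2) finM(1) by (rule finite_subset)
    then have "card (insert w T) = 4" "finite (insert w T)" using wT by auto
    moreover have "card (insert w R) \<le> card R + 1" using finM by (simp add: card_insert_if)
    ultimately show False
      using MR(1) R1 diff_card_le_card_Diff[of "insert w T" M] by linarith
  next
    case 3
    then obtain C where C: "C \<subseteq> M" "card C = 5" "\<forall>x\<in>M. \<forall>y\<in>M. E (\<not> c) x y \<longrightarrow> x \<in> C \<and> y \<in> C"
      unfolding in_five_def by blast
    have "card (M - C) \<le> card R"
      using MR C by (intro expand) auto
    then show False
      using MR(1) R1 C diff_card_le_card_Diff[of C M] finM finite_subset by fastforce
  next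
    case 4
    then obtain S T where ST: "S \<subseteq> M" "T \<subseteq> M" "card S = 3" "card T = 3"
      "\<forall>x\<in>M. \<forall>y\<in>M. E (\<not> c) x y \<longrightarrow> x \<in> S \<and> y \<in> S \<or> x \<in> T \<and> y \<in> T"
      unfolding in_two_triples_def by blast
    have "card (S \<union> T) \<le> 6" using card_Un_le[of S T] ST by simp
    moreover have "card M \<ge> 7" using MR(1) R1 by simp
    moreover have "finite (S \<union> T)" using ST(1,2) finM(1) finite_subset by blast
    ultimately have "\<not> M \<subseteq> S \<union> T" using card_mono[of "S \<union> T" M] by linarith
    then obtain x where x: "x \<in> M" "x \<notin> S" "x \<notin> T" by auto
    then have "\<forall>y\<in>M. \<not> E (\<not> c) x y" using ST(5) by blast
    then have "{y\<in>W. E (\<not> c) x y} \<subseteq> R" using MR(4) by blast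
    then have "card {y\<in>W. E (\<not> c) x y} \<le> 1" using R1 finM card_mono order_trans by blast
    then show False using red[of x] x MR by auto
  qed
qed

text \<open>A vertex outside a \<open>c\<close>-clique on six vertices has at most one
  \<open>c\<close>-neighbour \<open>q\<close> in it: a second one, together with the other four clique
  vertices, would give a fan with centre \<open>q\<close>. So the eight outside vertices are too
  sparsely joined to any five clique vertices.\<close>

lemma no_clique6:
  assumes K: "K \<subseteq> V" "card K = 6" "clique f c K" shows False
proof -
  have finK: "finite K" using K fin_sub by auto
  obtain z where z: "z \<in> K" using K by fastforce
  show False
  proof (rule no_sparse_5_8[of "K - {z}" "V - K" c])
    show "K - {z} \<subseteq> V" "card (K - {z}) = 5" "V - K \<subseteq> V" "(K - {z}) \<inter> (V - K) = {}" using K z finK by auto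
    show "card (V - K) = 8" using card_Diff_subset[of K V] K finK card14 by simp
    fix w assume w: "w \<in> V - K"
    show "card {q\<in>K - {z}. E c w q} \<le> 1"
    proof (rule ccontr)
      assume "\<not> ?thesis"
      then obtain q q' where q: "q \<in> K" "q' \<in> K" "q \<noteq> q'" "E c w q" "E c w q'"
        using finK card_le_Suc0_iff_eq[of "{q\<in>K - {z}. E c w q}"] by auto
      have "card (K - {q, q'}) = 4" using q K finK by (simp add: card_Diff_subset)
      then obtain r1 r2 r3 r4 where r: "K - {q, q'} = {r1, r2, r3, r4}" "distinct [r1, r2, r3, r4]"
        using card_eq_4_elems by metis
      have rK: "{r1, r2, r3, r4} \<subseteq> K - {q, q'}" using r by simp
      have wK: "w \<notin> K" "w \<in> V" using w by auto
      have cK: "E c x y" if "x \<in> K" "y \<in> K" "x \<noteq> y" for x y using K(3) that unfolding clique_def by blast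
      show False
      proof (rule fanD[of q w q' r1 r2 r3 r4 c])
        show "distinct [q, w, q', r1, r2, r3, r4]" using q r(2) rK wK by auto
        show "{q, w, q', r1, r2, r3, r4} \<subseteq> V" using q rK wK K by auto
        show "E c q w" "E c w q'" using q E_sym by auto
      qed (use q r(2) rK in \<open>auto intro!: cK\<close>)
    qed
  qed
qed

text \<open>Seven vertices include one outside both triples; in the other colour it is joined to both
  triples, which are completely joined to each other, and is the centre of a fan.\<close>

lemma no_two_triples:
  assumes v: "v \<in> V" and A: "A \<subseteq> N c v" "card A \<ge> 7"
  shows "\<not> in_two_triples (E c) A"
proof
  assume "in_two_triples (E c) A"
  then obtain S T where ST: "S \<subseteq> A" "T \<subseteq> A" "S \<inter> T = {}" "card S = 3" "card T = 3"
    "\<forall>x\<in>A. \<forall>y\<in>A. E c x y \<longrightarrow> x \<in> S \<and> y \<in> S \<or> x \<in> T \<and> y \<in> T"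
    unfolding in_two_triples_def by blast
  have AV: "A \<subseteq> V" using A N_sub by blast
  then have "finite A" using fin_sub by auto
  have "card (S \<union> T) \<le> 6" using card_Un_le[of S T] ST by simp
  moreover have "finite (S \<union> T)" using ST(1,2) \<open>finite A\<close> finite_subset by blast
  ultimately have "\<not> A \<subseteq> S \<union> T" using card_mono[of "S \<union> T" A] A(2) by linarith
  then obtain p where p: "p \<in> A" "p \<notin> S" "p \<notin> T" by auto
  obtain s1 s2 s3 where s: "S = {s1, s2, s3}" "distinct [s1, s2, s3]" using ST card_3_iff[of S] by auto
  obtain t1 t2 t3 where t: "T = {t1, t2, t3}" "distinct [t1, t2, t3]" using ST card_3_iff[of T] by auto
  have other: "E (\<not> c) x y" if "x \<in> A" "y \<in> A" "x \<noteq> y" "\<not> (x \<in> S \<and> y \<in> S)" "\<not> (x \<in> T \<and> y \<in> T)" for x y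
    using that ST(6) adj_other[of x y f c] by blast
  have cross: "E (\<not> c) x y" if "x \<in> S" "y \<in> T" for x y
    using other[of x y] that ST(1-3) by blast
  have pc: "E (\<not> c) p y" if "y \<in> S \<union> T" for y
    using other[of p y] that ST(1,2) p by blast
  show False
  proof (rule fanD[of p s1 t1 s2 t2 s3 t3 "\<not> c"])
    show "distinct [p, s1, t1, s2, t2, s3, t3]" using s t p(2,3) ST(3) by auto
    show "{p, s1, t1, s2, t2, s3, t3} \<subseteq> V" using p(1) s(1) t(1) ST(1,2) AV by auto
  qed (use s(1) t(1) in \<open>auto intro!: cross pc\<close>)
qed

text \<open>In eight \<open>c\<close>-neighbours of \<open>v\<close> a two-vertex cover leaves a
  \<open>K\<^sub>6\<close> of the other colour. In the second shape, four vertices are joined in the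
  other colour to each other and to a triple, which contains a fan. In the third, three vertices are
  joined in the other colour to everything, so a single edge of that colour among the five completes a
  fan; without one, the five form with \<open>v\<close> a \<open>c\<close>-clique on six vertices.\<close>

lemma degree_le_7:
  assumes v: "v \<in> V" shows "card (N c v) \<le> 7"
proof (rule ccontr)
  assume "\<not> ?thesis"
  then have "8 \<le> card (N c v)" by simp
  then obtain A where A: "A \<subseteq> N c v" "card A = 8" "finite A"
    by (metis obtain_subset_with_card_n)
  have AV: "A \<subseteq> V" using A N_sub by blast
  have vA: "v \<notin> A" "\<And>x. x \<in> A \<Longrightarrow> E c v x" using A E_irrefl unfolding nbh_def by auto
  consider "two_cover (E c) A" | "vertex_and_triple (E c) A" | "in_five (E c) A"
    using nbh_cases[OF v A(1)] no_two_triples[OF v A(1)] A(2) by auto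
  then show False
  proof cases
    case 1
    then obtain a b where ab: "\<forall>x\<in>A - {a, b}. \<forall>y\<in>A - {a, b}. \<not> E c x y"
      unfolding two_cover_def by blast
    have "card {a, b} \<le> 2" by (simp add: card_insert_if)
    then have "6 \<le> card (A - {a, b})"
      using diff_card_le_card_Diff[of "{a, b}" A] A(2) by simp
    then obtain K where K: "K \<subseteq> A - {a, b}" "card K = 6" by (metis obtain_subset_with_card_n)
    have "clique f (\<not> c) K" using ab K(1) adj_other[of _ _ f c] unfolding clique_def by blast
    then show False using no_clique6[of K "\<not> c"] K AV by blast
  next
    case 2
    then obtain w T where wT: "w \<in> A" "T \<subseteq> A" "w \<notin> T" "card T = 3"
      "\<forall>x\<in>A - {w}. \<forall>y\<in>A - {w}. E c x y \<longrightarrow> x \<in> T \<and> y \<in> T"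
      unfolding vertex_and_triple_def by blast
    have fT: "finite T" using wT(2) A(3) by (rule finite_subset)
    then have "card (A - insert w T) = 4"
      using wT A card_Diff_subset[of "insert w T" A] by simp
    then obtain p p1 p2 p3 where p: "A - insert w T = {p, p1, p2, p3}" "distinct [p, p1, p2, p3]"
      using card_eq_4_elems by metis
    have pA: "{p, p1, p2, p3} \<subseteq> A - insert w T" using p by simp
    obtain t1 t2 t3 where t: "T = {t1, t2, t3}" "distinct [t1, t2, t3]" using wT card_3_iff[of T] by auto
    have other: "E (\<not> c) x y" if "x \<in> A - insert w T" "y \<in> A - {w}" "x \<noteq> y" for x y
      using wT(5) that adj_other[of x y f c] by blast
    have tA: "{t1, t2, t3} \<subseteq> A - {w}" using t wT by auto
    have pt: "{p, p1, p2, p3} \<inter> {t1, t2, t3} = {}" using pA t(1) by auto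
    have oth: "E (\<not> c) x y" if "x \<in> {p, p1, p2, p3}" "y \<in> {p, p1, p2, p3, t1, t2, t3}" "x \<noteq> y" for x y
      using other[of x y] that pA tA by blast
    show False
    proof (rule fanD[of p p1 t1 p2 t2 p3 t3 "\<not> c"])
      show "distinct [p, p1, t1, p2, t2, p3, t3]" using p(2) t(2) pt by auto
      show "{p, p1, t1, p2, t2, p3, t3} \<subseteq> V" using pA tA AV by auto
    qed (rule oth; use p(2) t(2) pt in auto)+
  next
    case 3
    then obtain C where C: "C \<subseteq> A" "card C = 5" "\<forall>x\<in>A. \<forall>y\<in>A. E c x y \<longrightarrow> x \<in> C \<and> y \<in> C"
      unfolding in_five_def by blast
    have fC: "finite C" using C(1) A(3) by (rule finite_subset)
    have other: "E (\<not> c) x y" if "x \<in> A - C" "y \<in> A" "x \<noteq> y" for x y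
      using C(3) that adj_other[of x y f c] by blast
    have "card (A - C) = 3" using C A fC card_Diff_subset[of C A] by simp
    then obtain p q r where p: "A - C = {p, q, r}" "distinct [p, q, r]" using card_3_iff[of "A - C"] by auto
    have pA: "{p, q, r} \<subseteq> A - C" using p by simp
    show False
    proof (cases "clique f c C")
      case True
      have "clique f c (insert v C)" using True vA C(1) E_sym unfolding clique_def by auto
      moreover have "v \<notin> C" using vA(1) C(1) by blast
      then have "card (insert v C) = 6" using fC C(2) by simp
      ultimately show False using no_clique6[of "insert v C" c] C(1) AV v by auto
    next
      case False
      then obtain a b where ab: "a \<in> C" "b \<in> C" "a \<noteq> b" "E (\<not> c) a b"
        using adj_other[of _ _ f c] unfolding clique_def by blast
      have "card (C - {a, b}) \<ge> 3" using ab C fC by (simp add: card_Diff_subset)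
      then obtain d e e' where de: "{d, e, e'} \<subseteq> C - {a, b}" "distinct [d, e, e']"
        using card_ge_3_elems by metis
      have all: "{a, b, d, e} \<subseteq> C" using ab de by auto
      have pC: "{p, q, r} \<inter> {a, b, d, e} = {}" using all pA by blast
      have oth: "E (\<not> c) x y" if "x \<in> {p, q, r}" "y \<in> {p, q, r, a, b, d, e}" "x \<noteq> y" for x y
        using other[of x y] that pA all C(1) by blast
      show False
      proof (rule fanD[of p a b q d r e "\<not> c"])
        show "distinct [p, a, b, q, d, r, e]" using p(2) pC ab(3) de by auto
        show "{p, a, b, q, d, r, e} \<subseteq> V" using pA all C(1) AV by auto
        show "E (\<not> c) a b" by fact
      qed (rule oth; use p(2) pC in auto)+
    qed
  qed
qed

lemma degree_ge_6: "v \<in> V \<Longrightarrow> card (N c v) \<ge> 6"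
  using degree_sum[of v c] degree_le_7[of v "\<not> c"] by auto


text \<open>Call \<open>c\<close> blue and the other colour \<open>d\<close> red. Let \<open>U\<close>
  be the set of the nine vertices outside \<open>Q\<close>, and \<open>b x\<close> the set of blue
  neighbours of \<open>x\<close> in \<open>Q\<close>. Vertices of \<open>U\<close> with a common blue
  neighbour \<open>q\<close> in \<open>Q\<close> are red to each other, and their other blue neighbours
  in \<open>Q\<close> admit no two distinct representatives, because a blue edge between them, or such a
  pair of representatives, completes a blue fan with centre \<open>q\<close>. Hence at most one vertex
  of \<open>U\<close> has three or more blue neighbours in \<open>Q\<close>. If all but one vertex of
  \<open>U\<close> had at most one blue neighbour in \<open>Q\<close>, \<open>no_sparse_5_8\<close>
  would apply; so some \<open>x\<close> has exactly two, \<open>q1\<close> and \<open>q2\<close>. All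
  vertices that are blue to \<open>q1\<close> or \<open>q2\<close> are red to \<open>x\<close> and to
  the other three clique vertices \<open>Q3\<close>. Since \<open>x\<close> is red to \<open>Q3\<close>,
  its set \<open>D\<close> of red neighbours in \<open>U\<close>, which has at least three elements, has
  no red matching of size three into \<open>Q3\<close>. In both cases where this can happen,
  \<open>D\<close> has exactly three elements and the five remaining vertices \<open>W\<close>, all blue
  to \<open>x\<close>, have at most one blue neighbour each in \<open>Q\<close>. Then red degrees within
  \<open>W\<close> are at most two, so \<open>W\<close> contains two disjoint blue edges, and these form
  with \<open>q1 q2\<close> a blue fan with centre \<open>x\<close>.\<close>

lemma no_clique5:
  assumes Q: "Q \<subseteq> V" "card Q = 5" "clique f c Q" shows False
proof -
  define d where "d = (\<not> c)"
  define U where "U = V - Q"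
  define b where "b = (\<lambda>x. {q\<in>Q. E c x q})"
  have finQ: "finite Q" using Q fin_sub by auto
  have finU: "finite U" using fin unfolding U_def by auto
  have cardU: "card U = 9" using card_Diff_subset[of Q V] Q finQ card14 unfolding U_def by simp
  have UV: "U \<subseteq> V" and UQ: "U \<inter> Q = {}" unfolding U_def by auto
  have Ed: "E d x y \<longleftrightarrow> \<not> E c x y" if "x \<noteq> y" for x y using that unfolding d_def by (rule adj_other)
  have EdUQ: "E d x q \<longleftrightarrow> q \<notin> b x" "q \<in> b x \<longleftrightarrow> E c q x" if "x \<in> U" "q \<in> Q" for x q
    using Ed[of x q] that UQ E_sym unfolding b_def by auto
  have cQ: "E c x y" if "x \<in> Q" "y \<in> Q" "x \<noteq> y" for x y
    using Q(3) that unfolding clique_def by blast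
  have nbrs_red: "E d x y" if q: "q \<in> Q" and xy: "x \<in> U" "y \<in> U" "x \<noteq> y" "q \<in> b x" "q \<in> b y" for q x y
  proof (rule ccontr)
    assume "\<not> E d x y"
    then have "E c x y" using Ed xy by blast
    have "card (Q - {q}) = 4" using q Q finQ by simp
    then obtain r1 r2 r3 r4 where r: "Q - {q} = {r1, r2, r3, r4}" "distinct [r1, r2, r3, r4]"
      using card_eq_4_elems by metis
    have rQ: "{r1, r2, r3, r4} \<subseteq> Q - {q}" using r by simp
    have ne: "{x, y} \<inter> {q, r1, r2, r3, r4} = {}" using q rQ xy UQ by blast
    show False
    proof (rule fanD[of q x y r1 r2 r3 r4 c])
      show "distinct [q, x, y, r1, r2, r3, r4]" using ne r(2) rQ xy(3) by auto
      show "{q, x, y, r1, r2, r3, r4} \<subseteq> V" using q xy rQ Q(1) UV by auto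
      show "E c q x" "E c q y" using EdUQ q xy by auto
      show "E c x y" by fact
    qed (rule cQ; use q rQ r(2) in auto)+
  qed
  have no_sdr: False if q: "{q, q', q''} \<subseteq> Q" "distinct [q, q', q'']"
    and xy: "x \<in> U" "y \<in> U" "x \<noteq> y" "q \<in> b x" "q \<in> b y" "q' \<in> b x" "q'' \<in> b y" for q q' q'' x y
  proof -
    have "card (Q - {q, q', q''}) = 2" using q Q finQ by (simp add: card_Diff_subset)
    then obtain r s where r: "Q - {q, q', q''} = {r, s}" "r \<noteq> s" by (auto simp: card_2_iff)
    have rQ: "{r, s} \<subseteq> Q - {q, q', q''}" using r by simp
    have ne: "{x, y} \<inter> {q, q', q'', r, s} = {}" using q rQ xy UQ by blast
    show False
    proof (rule fanD[of q x q' y q'' r s c])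
      show "distinct [q, x, q', y, q'', r, s]" using ne q(2) r(2) rQ xy(3) by auto
      show "{q, x, q', y, q'', r, s} \<subseteq> V" using q(1) xy(1,2) rQ Q(1) UV by auto
      show "E c q x" "E c q y" "E c x q'" "E c y q''" using EdUQ q xy unfolding b_def by auto
    qed (rule cQ; use q rQ r(2) in auto)+
  qed
  have red_fan: False if "distinct [x, y1, y2, y3]" "{x, y1, y2, y3} \<subseteq> U" "distinct [r1, r2, r3]" "{r1, r2, r3} \<subseteq> Q"
    "E d x y1" "E d x y2" "E d x y3" "r1 \<notin> b x" "r2 \<notin> b x" "r3 \<notin> b x" "r1 \<notin> b y1" "r2 \<notin> b y2" "r3 \<notin> b y3"
  for x y1 y2 y3 r1 r2 r3
  proof -
    have ne: "{x, y1, y2, y3} \<inter> {r1, r2, r3} = {}" using that(2,4) UQ by blast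
    show False
    proof (rule fanD[of x y1 r1 y2 r2 y3 r3 d])
      show "distinct [x, y1, r1, y2, r2, y3, r3]" using ne that(1,3) by auto
      show "{x, y1, r1, y2, r2, y3, r3} \<subseteq> V" using that(2,4) UV Q(1) by auto
    qed (use that EdUQ in auto)
  qed
  \<comment> \<open>The degree bound leaves each vertex at least six neighbours in either colour, only four of
    which lie in \<open>Q\<close>.\<close>
  have two_blue: "card {x\<in>U. q \<in> b x} \<ge> 2" if q: "q \<in> Q" for q
  proof -
    have "N c q \<subseteq> {x\<in>U. q \<in> b x} \<union> (Q - {q})"
      using EdUQ(2) q E_irrefl unfolding nbh_def U_def by auto
    then have "card (N c q) \<le> card ({x\<in>U. q \<in> b x} \<union> (Q - {q}))"
      using finU finQ by (intro card_mono) auto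
    also have "\<dots> \<le> card {x\<in>U. q \<in> b x} + card (Q - {q})" by (rule card_Un_le)
    finally show ?thesis using degree_ge_6[of q c] q Q finQ by auto
  qed
  have many: "\<exists>w\<in>U - {z}. card (b w) \<ge> 2" if "z \<in> U" for z
  proof (rule ccontr)
    assume "\<not> ?thesis"
    then have few: "card {q\<in>Q. E c w q} \<le> 1" if "w \<in> U - {z}" for w
      using that unfolding b_def by force
    show False
    proof (rule no_sparse_5_8[OF Q(1,2) _ _ _ few])
      show "card (U - {z}) = 8" using cardU finU that by simp
    qed (use UV UQ in auto)
  qed
  have "\<exists>x\<in>U. card (b x) = 2"
  proof -
    have "U \<noteq> {}" using cardU by auto
    then obtain w where w: "w \<in> U" "card (b w) \<ge> 2" using many by blast
    obtain w' where w': "w' \<in> U" "w' \<noteq> w" "card (b w') \<ge> 2" using many[OF w(1)] by blast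
    have False if ge: "card (b w) \<ge> 3" "card (b w') \<ge> 3"
    proof -
      have finb: "finite (b x)" "b x \<subseteq> Q" for x using finQ unfolding b_def by auto
      have "card (b w \<union> b w') \<le> 5" using card_mono[OF finQ, of "b w \<union> b w'"] finb Q by auto
      then have "card (b w \<inter> b w') \<ge> 1" using card_Un_Int[of "b w" "b w'"] finb ge by auto
      then have "b w \<inter> b w' \<noteq> {}" by auto
      then obtain q where q: "q \<in> b w" "q \<in> b w'" by blast
      obtain q' where q': "q' \<in> b w" "q' \<noteq> q"
        using ge(1) card_mono[of "{q}" "b w"] by fastforce
      have "\<not> b w' \<subseteq> {q, q'}" using ge(2) q'(2) card_mono[of "{q, q'}" "b w'"] by auto
      then obtain q'' where q'': "q'' \<in> b w'" "q'' \<noteq> q" "q'' \<noteq> q'" by blast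
      show False
        using no_sdr[of q q' q'' w w'] q q' q'' w(1) w'(1,2) finb(2) by auto
    qed
    then have "card (b w) = 2 \<or> card (b w') = 2" using w(2) w'(3) by force
    then show ?thesis using w(1) w'(1) by blast
  qed
  then obtain x q1 q2 where x: "x \<in> U" "b x = {q1, q2}" "q1 \<noteq> q2" by (auto simp: card_2_iff)
  have q12: "q1 \<in> Q" "q2 \<in> Q" using x(2) unfolding b_def by auto
  have cluster: "b y \<subseteq> {p, p'} \<and> E d x y"
    if x: "x \<in> U" "b x = {p, p'}" "p \<noteq> p'" and y: "y \<in> U" "y \<noteq> x" "p \<in> b y \<or> p' \<in> b y" for x y p p'
  proof -
    have pQ: "p \<in> Q" "p' \<in> Q" "b y \<subseteq> Q" using x(2) unfolding b_def by auto
    have "E d x y" using nbrs_red[of p x y] nbrs_red[of p' x y] pQ x y by auto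
    moreover have "r \<in> {p, p'}" if "r \<in> b y" for r
    proof (rule ccontr)
      assume r: "r \<notin> {p, p'}"
      have "r \<in> Q" using that pQ by auto
      then show False
        using no_sdr[of p p' r x y] no_sdr[of p' p r x y] pQ x y that r by auto
    qed
    ultimately show ?thesis by blast
  qed
  define Q3 where "Q3 = Q - {q1, q2}"
  have Q3: "card Q3 = 3" "Q3 \<subseteq> Q" "finite Q3" "Q = {q1, q2} \<union> Q3"
    using q12 x(3) Q finQ unfolding Q3_def by (auto simp: card_Diff_subset)
  define D where "D = {y\<in>U. E d x y}"
  have finD: "finite D" "D \<subseteq> U" "x \<notin> D" using finU E_irrefl unfolding D_def by auto
  have D3: "card D \<ge> 3"
  proof -
    have "N d x \<subseteq> D \<union> Q3"
      using EdUQ[of x] x unfolding nbh_def D_def U_def Q3_def by auto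
    then have "card (N d x) \<le> card (D \<union> Q3)" using finD Q3 by (intro card_mono) auto
    also have "\<dots> \<le> card D + card Q3" by (rule card_Un_le)
    finally show ?thesis using degree_ge_6[of x d] x UV Q3 by auto
  qed
  have "\<not> {y\<in>U. q1 \<in> b y} \<subseteq> {x}" using two_blue[OF q12(1)] card_mono[of "{x}" "{y\<in>U. q1 \<in> b y}"] by auto
  then obtain u where u: "u \<in> U" "u \<noteq> x" "q1 \<in> b u" by blast
  have uD: "u \<in> D" "b u \<inter> Q3 = {}" using cluster[OF x u(1,2)] u unfolding D_def Q3_def by auto
  \<comment> \<open>The vertex \<open>u\<close> is red to all of \<open>Q3\<close>, so it can always take the
    third representative.\<close>
  have no_pair: False
    if yz: "y \<in> D - {u}" "z \<in> D - {u}" "y \<noteq> z" and q: "q \<in> Q3 - b y" "q' \<in> Q3 - b z" "q \<noteq> q'" for y z q q'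
  proof -
    have "card (Q3 - {q, q'}) = 1" using q Q3 by (simp add: card_Diff_subset)
    then obtain r where r: "r \<in> Q3" "r \<noteq> q" "r \<noteq> q'" by (metis DiffE card_1_singletonE insertCI)
    show False
    proof (rule red_fan[of x y z u q q' r])
      show "distinct [x, y, z, u]" using yz u finD(3) by auto
      show "{x, y, z, u} \<subseteq> U" using yz u x finD(2) by auto
      show "distinct [q, q', r]" "{q, q', r} \<subseteq> Q" using q r Q3(2) by auto
      show "E d x y" "E d x z" "E d x u" using yz uD unfolding D_def by auto
      show "q \<notin> b x" "q' \<notin> b x" "r \<notin> b x" using q r x(2) unfolding Q3_def by auto
      show "q \<notin> b y" "q' \<notin> b z" "r \<notin> b u" using q r uD by auto
    qed
  qed
  define W where "W = U - insert x D"
  have W_off: "q1 \<notin> b w" "q2 \<notin> b w" if "w \<in> W" for w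
    using cluster[OF x, of w] that unfolding W_def D_def by auto
  have finish: False if D: "card D = 3" and few: "\<And>w. w \<in> W \<Longrightarrow> card (b w) \<le> 1"
  proof -
    have WU: "W \<subseteq> U" "finite W" using finU unfolding W_def by auto
    have W5: "card W = 5"
      using D cardU finD x(1) card_Diff_subset[of "insert x D" U] unfolding W_def by auto
    have "card {y\<in>W. E c w y} \<ge> 2" if w: "w \<in> W" for w
    proof -
      have "card {y\<in>W. E (\<not> c) w y} \<le> 2"
        using few unfolding b_def
        by (intro few_nbrs_of_opposite_colour[OF Q(1,2) _ _ _ w]) (use WU UV UQ in auto)
      moreover have "W \<subseteq> V" using WU UV by blast
      ultimately show ?thesis using card_nbrs[of W w c] w W5 by auto
    qed
    then obtain a a' e e' where m: "{a, a', e, e'} \<subseteq> W" "distinct [a, a', e, e']" "E c a a'" "E c e e'"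
      using two_disjoint_edges[of "E c" W, OF E_sym E_irrefl WU(2)] W5 by auto
    have blue: "E c x w" if "w \<in> W" for w using that Ed[of x w] unfolding W_def D_def by auto
    have ne: "{x, a, a', e, e'} \<inter> {q1, q2} = {}" using m(1) x(1) WU(1) q12 UQ by blast
    show False
    proof (rule fanD[of x a a' e e' q1 q2 c])
      show "distinct [x, a, a', e, e', q1, q2]" using ne m(1,2) x(3) unfolding W_def by auto
      show "{x, a, a', e, e', q1, q2} \<subseteq> V" using m(1) x(1) WU(1) UV q12 Q(1) by auto
      show "E c x q1" "E c x q2" using x(2) unfolding b_def by auto
      show "E c q1 q2" using cQ q12 x(3) by blast
    qed (use m blue in auto)
  qed
  show False
  \<comment> \<open>No two vertices of \<open>D\<close> other than \<open>u\<close> have distinct red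
    representatives in \<open>Q3\<close>. Either one of them has no red neighbour there, or
    all of them have the same single one.\<close>
  proof (cases "\<exists>z\<in>D - {u}. Q3 \<subseteq> b z")
    case True
    then obtain z where z: "z \<in> D" "z \<noteq> u" "Q3 \<subseteq> b z" by blast
    have zU: "z \<in> U" "z \<noteq> x" using z(1) finD by auto
    \<comment> \<open>Two vertices of \<open>Q3\<close> blue to \<open>y\<close> would leave distinct
      representatives for \<open>y\<close> and \<open>z\<close>.\<close>
    have le1: "card (b y \<inter> Q3) \<le> 1" if y: "y \<in> U" "y \<noteq> z" for y
    proof (rule ccontr)
      assume "\<not> ?thesis"
      then obtain q q' where q: "q \<in> b y" "q \<in> Q3" "q' \<in> b y" "q' \<in> Q3" "q \<noteq> q'"
        using Q3(3) card_le_Suc0_iff_eq[of "b y \<inter> Q3"] by auto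
      have "card (Q3 - {q, q'}) = 1" using q Q3 by (simp add: card_Diff_subset)
      then obtain r where r: "r \<in> Q3" "r \<noteq> q" "r \<noteq> q'" by (metis DiffE card_1_singletonE insertCI)
      show False using no_sdr[of q q' r y z] q r y zU(1) z(3) Q3(2) by auto
    qed
    have "card D = 3"
    proof (rule ccontr)
      assume "card D \<noteq> 3"
      then have "card (D - {z, u}) \<ge> 2" using D3 z uD finD by (simp add: card_Diff_subset)
      then obtain y y' where y: "y \<in> D - {z, u}" "y' \<in> D - {z, u}" "y \<noteq> y'"
        using card_ge_2_elems[of "D - {z, u}"] by auto
      have ge2: "card (Q3 - b t) \<ge> 2" if "t \<in> D - {z, u}" for t
      proof -
        have "card (Q3 - b t) = card Q3 - card (b t \<inter> Q3)"
          using card_Diff_subset_Int[of Q3 "b t"] Q3(3) by (simp add: Int_commute)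
        then show ?thesis using le1[of t] that finD(2) Q3(1) by auto
      qed
      have "Q3 - b y \<noteq> {}" using ge2[OF y(1)] by (metis card.empty not_numeral_le_zero)
      then obtain q where q: "q \<in> Q3 - b y" by blast
      have "\<not> Q3 - b y' \<subseteq> {q}" using ge2[OF y(2)] card_mono[of "{q}" "Q3 - b y'"] by auto
      then obtain q' where "q' \<in> Q3 - b y'" "q' \<noteq> q" by blast
      then show False using no_pair[of y y' q q'] y q by auto
    qed
    moreover have "card (b w) \<le> 1" if w: "w \<in> W" for w
    proof -
      have "b w \<inter> Q3 = b w" using W_off[OF w] Q3(4) unfolding b_def by auto
      moreover have "w \<in> U" "w \<noteq> z" using w z(1) unfolding W_def by auto
      ultimately show ?thesis using le1[of w] by simp
    qed
    ultimately show False by (rule finish)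
  next
    case False
    then have some_red: "\<exists>q. q \<in> Q3 - b z" if "z \<in> D - {u}" for z using that by blast
    have "card (D - {u}) \<ge> 2" using D3 uD finD by simp
    then obtain y y' where y: "y \<in> D - {u}" "y' \<in> D - {u}" "y \<noteq> y'"
      using card_ge_2_elems[of "D - {u}"] by auto
    obtain q5 where q5: "q5 \<in> Q3 - b y" using some_red[OF y(1)] by blast
    have y5: "Q3 - b y' = {q5}" using no_pair[of y y' q5] y q5 some_red[OF y(2)] by blast
    have only5: "Q3 - b z = {q5}" if z: "z \<in> D - {u}" for z
    proof (cases "z = y")
      case True
      then show ?thesis using no_pair[of y y' _ q5] y y5 q5 by blast
    next
      case False
      then show ?thesis using no_pair[of y z q5] z y q5 some_red[OF z] by blast
    qed
    have "card (Q3 - {q5}) = 2" using q5 Q3 by simp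
    then obtain q3 q4 where q34: "Q3 - {q5} = {q3, q4}" "q3 \<noteq> q4" by (auto simp: card_2_iff)
    have q345: "q3 \<in> Q3" "q4 \<in> Q3" "q3 \<noteq> q5" "q4 \<noteq> q5" "Q3 = {q3, q4, q5}" using q34 q5 by auto
    have bz: "b z = {q3, q4}" if z: "z \<in> D - {u}" for z
    proof -
      have zU: "z \<in> U" "z \<noteq> x" using z finD by auto
      have in34: "q3 \<in> b z" "q4 \<in> b z" "q5 \<notin> b z" using only5[OF z] q345 by auto
      have "q1 \<notin> b z \<and> q2 \<notin> b z" using cluster[OF x zU] in34(1) q345(1) unfolding Q3_def by blast
      moreover have "b z \<subseteq> {q1, q2} \<union> {q3, q4, q5}" using Q3(4) q345(5) unfolding b_def by auto
      ultimately show ?thesis using in34 by auto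
    qed
    \<comment> \<open>The vertices \<open>y\<close> and \<open>y'\<close> are a second pair of the same kind as
      \<open>x\<close> and \<open>u\<close>, with \<open>q3\<close> and \<open>q4\<close> in
      place of \<open>q1\<close> and \<open>q2\<close>; a third vertex blue to
      \<open>q3\<close> or \<open>q4\<close> gives a red fan with centre \<open>y\<close>.\<close>
    have cluster_y: "w \<in> {y, y'}" if w: "w \<in> U" "q3 \<in> b w \<or> q4 \<in> b w" for w
    proof (rule ccontr)
      assume nw: "w \<notin> {y, y'}"
      have yU: "y \<in> U" "y' \<in> U" "E d x y" "x \<notin> {y, y'}" using y finD unfolding D_def by auto
      have bw: "b w \<subseteq> {q3, q4}" "E d y w" using cluster[OF yU(1) bz[OF y(1)] q34(2), of w] w nw by auto
      have yy': "E d y y'" using nbrs_red[of q3 y y'] yU y bz[OF y(1)] bz[OF y(2)] q345(1) Q3(2) by auto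
      have wx: "w \<noteq> x" using w x(2) q345 unfolding Q3_def by auto
      have off: "{q1, q2} \<inter> {q3, q4} = {}" using q345 unfolding Q3_def by auto
      show False
      proof (rule red_fan[of y x w y' q5 q1 q2])
        show "distinct [y, x, w, y']" using y(3) nw yU(4) wx by auto
        show "{y, x, w, y'} \<subseteq> U" using yU x w by auto
        show "distinct [q5, q1, q2]" "{q5, q1, q2} \<subseteq> Q" using x(3) q5 q12 unfolding Q3_def by auto
        show "E d y x" "E d y w" "E d y y'" using yU bw yy' E_sym by auto
        show "q5 \<notin> b x" using x(2) q5 unfolding Q3_def by auto
        show "q5 \<notin> b y" using q5 by auto
      qed (use bz[OF y(1)] bz[OF y(2)] bw off in auto)
    qed
    have "D = {u, y, y'}"
    proof
      show "{u, y, y'} \<subseteq> D" using uD y by auto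
      show "D \<subseteq> {u, y, y'}" using cluster_y bz finD(2) by blast
    qed
    then have "card D = 3" using y by auto
    moreover have "card (b w) \<le> 1" if w: "w \<in> W" for w
    proof -
      have wU: "w \<in> U" "w \<noteq> y" "w \<noteq> y'" using w \<open>D = {u, y, y'}\<close> unfolding W_def by auto
      have "q3 \<notin> b w" "q4 \<notin> b w" using cluster_y[OF wU(1)] wU by auto
      then have "b w \<subseteq> {q5}" using W_off[OF w] Q3(4) q345(5) unfolding b_def by auto
      then show ?thesis using card_mono[of "{q5}" "b w"] by auto
    qed
    ultimately show False by (rule finish)
  qed
qed

section \<open>Vertices of degree seven\<close>


lemma clique_insert:
  assumes "clique f c S" "\<And>x. x \<in> S \<Longrightarrow> E c v x" shows "clique f c (insert v S)"
proof -
  have "E c x v" if "x \<in> S" for x using assms(2)[OF that] E_sym[of c x v] by blast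
  then show ?thesis using assms unfolding clique_def by auto
qed

text \<open>The shape of the neighbourhood of a vertex \<open>v\<close> of degree seven in colour
  \<open>c\<close>. Nothing is said about the edges from \<open>w\<close> to \<open>I\<close> and
  \<open>T\<close>.\<close>

definition split7 :: "bool \<Rightarrow> 'a \<Rightarrow> 'a \<Rightarrow> 'a set \<Rightarrow> 'a set \<Rightarrow> bool" where
  "split7 c v w I T \<longleftrightarrow> v \<in> V \<and> N c v = insert w (I \<union> T) \<and> w \<notin> I \<union> T \<and> I \<inter> T = {} \<and>
     card I = 3 \<and> card T = 3 \<and> clique f (\<not> c) I \<and> clique f c T \<and> (\<forall>i\<in>I. \<forall>t\<in>T. E (\<not> c) i t)"

text \<open>A two-vertex cover of the neighbourhood leaves a \<open>K\<^sub>5\<close> of the other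
  colour. In the second shape the triple \<open>T\<close> is a \<open>c\<close>-clique, because an edge
  of the other colour in it would extend the three vertices of \<open>I\<close> to such a
  \<open>K\<^sub>5\<close>; this is the asserted structure. In the third shape two vertices
  \<open>p\<close> and \<open>q\<close> are joined in the other colour to everything, so the five
  vertices of \<open>C\<close> contain no two disjoint edges of that colour; thus these edges form a
  triangle, which gives a \<open>K\<^sub>5\<close> with \<open>p\<close> and \<open>q\<close>, or a
  star, and deleting its centre leaves four vertices that give a \<open>K\<^sub>5\<close> with
  \<open>v\<close>.\<close>

lemma split7_exists:
  assumes v: "v \<in> V" and deg: "card (N c v) = 7"
  shows "\<exists>w I T. split7 c v w I T"
proof -
  define A where "A = N c v"
  have A: "A \<subseteq> N c v" "card A = 7" "A \<subseteq> V" using deg N_sub unfolding A_def by auto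
  have finA: "finite A" using A(3) fin_sub by blast
  have vA: "v \<notin> A" "\<And>x. x \<in> A \<Longrightarrow> E c v x" using E_irrefl unfolding A_def nbh_def by auto
  have Ed: "E (\<not> c) x y \<longleftrightarrow> \<not> E c x y" if "x \<noteq> y" for x y using that by (rule adj_other)
  consider "two_cover (E c) A" | "vertex_and_triple (E c) A" | "in_five (E c) A"
    using nbh_cases[OF v A(1)] no_two_triples[OF v A(1)] A(2) by auto
  then show ?thesis
  proof cases
    case 1
    then obtain a b where ab: "\<forall>x\<in>A - {a, b}. \<forall>y\<in>A - {a, b}. \<not> E c x y"
      unfolding two_cover_def by blast
    have "card {a, b} \<le> 2" by (simp add: card_insert_if)
    then have "5 \<le> card (A - {a, b})"
      using diff_card_le_card_Diff[of "{a, b}" A] A(2) by simp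
    then obtain K where K: "K \<subseteq> A - {a, b}" "card K = 5" by (metis obtain_subset_with_card_n)
    have "clique f (\<not> c) K" using ab K(1) Ed unfolding clique_def by blast
    then show ?thesis using no_clique5[of K "\<not> c"] K A(3) by blast
  next
    case 2
    then obtain w T where wT: "w \<in> A" "T \<subseteq> A" "w \<notin> T" "card T = 3"
      "\<forall>x\<in>A - {w}. \<forall>y\<in>A - {w}. E c x y \<longrightarrow> x \<in> T \<and> y \<in> T"
      unfolding vertex_and_triple_def by blast
    have finT: "finite T" using wT(2) finA by (rule finite_subset)
    define I where "I = A - insert w T"
    have I: "card I = 3" "I \<subseteq> A" "finite I"
      using wT A(2) finA finT card_Diff_subset[of "insert w T" A] unfolding I_def by auto
    have other: "E (\<not> c) x y" if "x \<in> I" "y \<in> A - {w}" "x \<noteq> y" for x y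
      using wT(5) that Ed[of x y] unfolding I_def by blast
    have "clique f c T"
    proof (rule ccontr)
      assume "\<not> ?thesis"
      then obtain t t' where t: "t \<in> T" "t' \<in> T" "t \<noteq> t'" "E (\<not> c) t t'" using Ed unfolding clique_def by blast
      have sub: "insert t (insert t' I) \<subseteq> A" using t wT(2) I by auto
      have "t \<notin> I" "t' \<notin> I" using t unfolding I_def by auto
      then have "card (insert t (insert t' I)) = 5" using I t(3) by simp
      moreover have "E (\<not> c) x y" if "x \<in> insert t (insert t' I)" "y \<in> insert t (insert t' I)" "x \<noteq> y" for x y
      proof (cases "x \<in> I \<or> y \<in> I")
        case True
        have "x \<in> A - {w}" "y \<in> A - {w}" using that t wT(2,3) unfolding I_def by auto
        then show ?thesis using True other[of x y] other[of y x] that(3) E_sym by blast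
      next
        case False
        then show ?thesis using that t E_sym by blast
      qed
      ultimately show False
        using no_clique5[of "insert t (insert t' I)" "\<not> c"] sub A(3) unfolding clique_def by blast
    qed
    moreover have "clique f (\<not> c) I" using other unfolding clique_def I_def by blast
    moreover have "\<forall>i\<in>I. \<forall>t\<in>T. E (\<not> c) i t" using other wT(2,3) unfolding I_def by blast
    moreover have "N c v = insert w (I \<union> T)" "w \<notin> I \<union> T" "I \<inter> T = {}"
      using wT(1-3) unfolding A_def[symmetric] I_def by auto
    ultimately show ?thesis using v I(1) wT(4) unfolding split7_def by blast
  next
    case 3
    then obtain C where C: "C \<subseteq> A" "card C = 5" "\<forall>x\<in>A. \<forall>y\<in>A. E c x y \<longrightarrow> x \<in> C \<and> y \<in> C"
      unfolding in_five_def by blast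
    have finC: "finite C" using C(1) finA by (rule finite_subset)
    have "card (A - C) = 2" using C A(2) finC card_Diff_subset[of C A] by simp
    then obtain p q where p: "A - C = {p, q}" "p \<noteq> q" by (auto simp: card_2_iff)
    have pA: "p \<in> A - C" "q \<in> A - C" using p by auto
    have other: "E (\<not> c) x y" if "x \<in> {p, q}" "y \<in> insert p (insert q C)" "x \<noteq> y" for x y
      using C(1,3) that pA Ed[of x y] by blast
    have "\<not> clique f c C" using no_clique5[of C c] C(1,2) A(3) by blast
    then obtain a b where ab: "a \<in> C" "b \<in> C" "a \<noteq> b" "E (\<not> c) a b" using Ed unfolding clique_def by blast
    have no2: False if "{x, x', y, y'} \<subseteq> C" "distinct [x, x', y, y']" "E (\<not> c) x x'" "E (\<not> c) y y'" for x x' y y'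
    proof -
      have "card (C - {x, x', y, y'}) = 1" using that C(2) finC by (simp add: card_Diff_subset)
      then obtain e where e: "e \<in> C" "e \<notin> {x, x', y, y'}" by (metis DiffE card_1_singletonE insertCI)
      have ne: "{p, q} \<inter> {x, x', y, y', e} = {}" using pA that(1) e(1) by blast
      show False
      proof (rule fanD[of p x x' y y' q e "\<not> c"])
        show "distinct [p, x, x', y, y', q, e]" using ne that(2) e(2) p(2) by auto
        show "{p, x, x', y, y', q, e} \<subseteq> V" using that(1) e(1) pA C(1) A(3) by auto
        show "E (\<not> c) x x'" "E (\<not> c) y y'" by fact+
      qed (rule other; use ne that(1) e(1) p(2) in auto)+
    qed
    define R where "R = C - {a, b}"
    have R: "card R = 3" "R \<subseteq> C" "finite R" "a \<notin> R" "b \<notin> R"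
      using ab C(2) finC unfolding R_def by (auto simp: card_Diff_subset)
    have redR: "E c x y" if "x \<in> R" "y \<in> R" "x \<noteq> y" for x y
      using no2[of a b x y] ab that Ed[of x y] unfolding R_def by auto
    have tri: False if x: "x \<in> R" "E (\<not> c) a x" "E (\<not> c) b x" for x
    proof -
      have "{a, b, x} \<subseteq> C" "x \<noteq> a" "x \<noteq> b" using x R ab by auto
      then have "p \<notin> {q, a, b, x}" "q \<notin> {a, b, x}" using pA p(2) by auto
      then have "card {p, q, a, b, x} = 5" using ab(3) \<open>x \<noteq> a\<close> \<open>x \<noteq> b\<close> by simp
      moreover have "clique f (\<not> c) {p, q, a, b, x}"
      proof -
        have abx: "E (\<not> c) b a" "E (\<not> c) x a" "E (\<not> c) x b" using ab(4) x(2,3) E_sym by auto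
        have "E (\<not> c) y z" if "y \<in> {p, q, a, b, x}" "z \<in> {p, q, a, b, x}" "y \<noteq> z" for y z
        proof (cases "y \<in> {p, q} \<or> z \<in> {p, q}")
          case True
          have "y \<in> insert p (insert q C)" "z \<in> insert p (insert q C)"
            using that(1,2) \<open>{a, b, x} \<subseteq> C\<close> by auto
          then show ?thesis using True other[of y z] other[of z y] that(3) E_sym[of "\<not> c" y z] by metis
        next
          case False
          then show ?thesis using that abx ab(4) x(2,3) by auto
        qed
        then show ?thesis unfolding clique_def by blast
      qed
      moreover have "{p, q, a, b, x} \<subseteq> V" using pA \<open>{a, b, x} \<subseteq> C\<close> C(1) A(3) by blast
      ultimately show False using no_clique5[of "{p, q, a, b, x}" "\<not> c"] by blast
    qed
    have isol: False if z: "z \<in> C" "z \<notin> R" "\<forall>x\<in>R. \<not> E (\<not> c) z x" for z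
    proof -
      have sub: "insert z R \<subseteq> A" using z(1) R C(1) by blast
      have "v \<notin> insert z R" using vA(1) sub by blast
      then have "card (insert v (insert z R)) = 5" using z(2) R by simp
      moreover have "clique f c (insert v (insert z R))"
      proof -
        have zx: "E c z x" if "x \<in> R" for x using z that Ed[of z x] by blast
        have vx: "E c v x" if "x \<in> insert z R" for x using vA(2) sub that by blast
        have "clique f c R" using redR unfolding clique_def by blast
        then show ?thesis using zx vx by (intro clique_insert)
      qed
      moreover have "insert v (insert z R) \<subseteq> V" using v sub A(3) by blast
      ultimately show False using no_clique5[of "insert v (insert z R)" c] by blast
    qed
    obtain x where x: "x \<in> R" "E (\<not> c) a x" using isol[of a] ab R by blast
    obtain y where y: "y \<in> R" "E (\<not> c) b y" using isol[of b] ab R by blast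
    have "x \<noteq> y" using tri x y by blast
    then show ?thesis using no2[of a x b y] x y ab R by auto
  qed
qed

text \<open>Call \<open>c\<close> red. The vertex \<open>i\<close> has five blue neighbours in
  \<open>I\<close> and \<open>T\<close>, so one or two others. If there were two, the blue neighbourhood
  of \<open>i\<close> would have the shape \<open>split7\<close> with the colours exchanged, in which
  all but one vertex have red degree at least three; but the two other vertices of \<open>I\<close> have
  red degree at most two there. So there is one more blue neighbour \<open>x\<close>. It is red to
  \<open>T\<close>, since otherwise the blue edges from \<open>I\<close> to \<open>T\<close> and one
  from \<open>x\<close> to \<open>T\<close> form a fan with centre \<open>i\<close>. As
  \<open>v\<close>, \<open>w\<close> and \<open>T\<close> do not form a red clique, \<open>x\<close> is
  not \<open>w\<close>, which is therefore red to \<open>i\<close>.\<close>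

lemma split7_inner:
  assumes s: "split7 c v w I T" and i: "i \<in> I"
  shows "card (N c i) = 7 \<and> E c w i \<and> (\<exists>x. N (\<not> c) i \<subseteq> insert x (I \<union> T))"
proof -
  define d where "d = (\<not> c)"
  have cd: "c = (\<not> d)" unfolding d_def by simp
  have v: "v \<in> V" and Nv: "N c v = insert w (I \<union> T)" and w: "w \<notin> I \<union> T" and IT: "I \<inter> T = {}"
    and cards: "card I = 3" "card T = 3"
    and cl: "\<And>x y. x \<in> I \<Longrightarrow> y \<in> I \<Longrightarrow> x \<noteq> y \<Longrightarrow> E d x y" "\<And>x y. x \<in> T \<Longrightarrow> y \<in> T \<Longrightarrow> x \<noteq> y \<Longrightarrow> E c x y"
    and cross: "\<And>x y. x \<in> I \<Longrightarrow> y \<in> T \<Longrightarrow> E d x y"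
    using s unfolding split7_def clique_def d_def by auto
  have subV: "insert w (I \<union> T) \<subseteq> V" using Nv N_sub[of c v] by simp
  have vE: "E c v x" if "x \<in> insert w (I \<union> T)" for x using that Nv unfolding nbh_def by auto
  have v_notin: "v \<notin> insert w (I \<union> T)" using vE E_irrefl by blast
  have fins: "finite I" "finite T" using subV fin_sub by auto
  have iV: "i \<in> V" using i subV by auto
  have Ed: "E d x y \<longleftrightarrow> \<not> E c x y" if "x \<noteq> y" for x y using that unfolding d_def by (rule adj_other)
  define X where "X = N d i - (I \<union> T)"
  have Ni: "N d i = (I - {i}) \<union> T \<union> X"
  proof
    show "N d i \<subseteq> (I - {i}) \<union> T \<union> X" using E_irrefl unfolding X_def nbh_def by blast
    have "I - {i} \<subseteq> N d i" using cl(1)[OF i] subV unfolding nbh_def by blast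
    moreover have "T \<subseteq> N d i" using cross[OF i] subV unfolding nbh_def by blast
    ultimately show "(I - {i}) \<union> T \<union> X \<subseteq> N d i" unfolding X_def by blast
  qed
  have "i \<notin> T" using i IT by blast
  have finX: "finite X" using fin_sub N_sub unfolding X_def by (meson finite_Diff)
  have disj: "(I - {i}) \<inter> T = {}" "((I - {i}) \<union> T) \<inter> X = {}" using IT unfolding X_def by auto
  have "card (N d i) = card (I - {i}) + card T + card X"
    unfolding Ni using card_Un_disjoint[OF _ _ disj(2)] card_Un_disjoint[OF _ _ disj(1)] fins finX by simp
  then have degi: "card (N d i) = 5 + card X" using cards i fins by simp
  have card2: "card (I - {i}) = 2" using cards i fins by simp
  then obtain j k where jk: "I - {i} = {j, k}" "j \<noteq> k" by (auto simp: card_2_iff)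
  have jkI: "j \<in> I" "k \<in> I" "j \<noteq> i" "k \<noteq> i" using jk by auto
  have not7: "card (N d i) \<noteq> 7"
  proof
    assume deg7: "card (N d i) = 7"
    then obtain w' I' T' where s': "split7 d i w' I' T'" using split7_exists[OF iV] by blast
    have X2: "card X = 2" using deg7 degi by simp
    have "l = w'" if l: "l \<in> I" "l \<noteq> i" for l
    proof (rule ccontr)
      assume "l \<noteq> w'"
      moreover have "l \<in> N d i" using l Ni by auto
      ultimately have "l \<in> I' \<or> l \<in> T'" using s' unfolding split7_def by auto
      moreover have sub: "I' \<subseteq> N d i" "T' \<subseteq> N d i" and c3: "card I' = 3" "card T' = 3"
        and red: "\<And>x y. x \<in> I' \<Longrightarrow> y \<in> T' \<Longrightarrow> E c x y"
        using s' unfolding split7_def cd[symmetric] by auto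
      ultimately obtain S where S: "card S = 3" "S \<subseteq> N d i" "\<forall>x\<in>S. E c l x"
        using E_sym by metis
      have "S \<subseteq> X"
      proof
        fix x assume x: "x \<in> S"
        have "E c l x" using S(3) x by blast
        then have "l \<noteq> x" using E_irrefl by blast
        then have "\<not> E d l x" using \<open>E c l x\<close> Ed by blast
        then have "x \<notin> I \<union> T" using cl(1)[of l x] cross[of l x] l(1) \<open>l \<noteq> x\<close> by blast
        then show "x \<in> X" using S(2) x unfolding X_def by blast
      qed
      then show False using card_mono[OF finX, of S] S(1) X2 by simp
    qed
    then show False using jkI jk(2) by blast
  qed
  have deg6: "card (N d i) = 6" using not7 degree_le_7[OF iV, of d] degree_ge_6[OF iV, of d] by linarith
  then have deg7: "card (N c i) = 7" using degree_sum[OF iV, of c] unfolding d_def by simp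
  have X1: "card X = 1" using deg6 degi by simp
  obtain x where x: "X = {x}" using X1 by (rule card_1_singletonE)
  have xi: "E d i x" "x \<in> V" "x \<notin> I \<union> T" using x unfolding X_def nbh_def by auto
  have xT: "E c x t" if t: "t \<in> T" for t
  proof (rule ccontr)
    assume "\<not> E c x t"
    then have xt: "E d x t" using Ed[of x t] t xi(3) by blast
    have "card (T - {t}) = 2" using cards t fins by simp
    then obtain t' t'' where t': "T - {t} = {t', t''}" "t' \<noteq> t''" by (auto simp: card_2_iff)
    have tT: "t' \<in> T" "t'' \<in> T" "t' \<noteq> t" "t'' \<noteq> t" using t' by auto
    have ne: "{i, j, k} \<inter> {t, t', t''} = {}" "x \<notin> {i, j, k, t, t', t''}" using i jkI tT t IT xi(3) by auto
    show False
    proof (rule fanD[of i j t' k t'' x t d])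
      show "distinct [i, j, t', k, t'', x, t]" using ne jkI jk(2) tT t'(2) by auto
      show "{i, j, t', k, t'', x, t} \<subseteq> V" using i jkI tT t subV xi(2) by auto
      show "E d i x" "E d x t" by fact+
      show "E d i j" "E d i k" using cl(1) i jkI by auto
    qed (use cross i jkI tT t in auto)
  qed
  have "x \<noteq> w"
  proof
    assume xw: "x = w"
    have "v \<notin> insert w T" using v_notin by blast
    moreover have "w \<notin> T" using w by blast
    ultimately have "card (insert v (insert w T)) = 5" using cards fins by simp
    moreover have "clique f c (insert v (insert w T))"
    proof -
      have "clique f c T" using cl(2) unfolding clique_def by blast
      moreover have "E c w y" if "y \<in> T" for y using xT[OF that] unfolding xw .
      moreover have "E c v y" if "y \<in> insert w T" for y using vE that by blast
      ultimately show ?thesis by (intro clique_insert)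
    qed
    moreover have "insert v (insert w T) \<subseteq> V" using v subV by blast
    ultimately show False using no_clique5[of "insert v (insert w T)" c] by blast
  qed
  have "w \<noteq> i" using w i by blast
  moreover have "w \<notin> N d i"
  proof
    assume "w \<in> N d i"
    then have "w \<in> X" using w unfolding X_def by blast
    then show False using x \<open>x \<noteq> w\<close> by blast
  qed
  ultimately have "E c w i"
    using Ed[of i w] subV E_sym[of c w i] unfolding nbh_def by simp
  moreover have "N d i \<subseteq> insert x (I \<union> T)" using Ni x by blast
  ultimately show ?thesis using deg7 unfolding d_def by blast
qed

text \<open>Call \<open>c\<close> red and choose \<open>i\<close> in \<open>I\<close>. The red
  neighbourhood of \<open>i\<close> contains \<open>v\<close>, and has a shape \<open>w'\<close>,
  \<open>I'\<close>, \<open>T'\<close> of its own. The only red neighbour of \<open>v\<close> in it can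
  be \<open>w\<close>, because \<open>I\<close> and \<open>T\<close> are blue to \<open>i\<close>. A
  vertex of \<open>T'\<close> has two red neighbours in it and \<open>w'\<close> has three, by
  \<open>split7_inner\<close>. So \<open>v\<close> lies in \<open>I'\<close>, and \<open>w'\<close>,
  being red to \<open>v\<close>, is \<open>w\<close>. Therefore \<open>w\<close> is red to
  \<open>I\<close> and to \<open>I' = {v, b, b'}\<close>. Since a vertex of \<open>I\<close> has only
  one blue neighbour outside \<open>I\<close> and \<open>T\<close>, there are three disjoint red edges
  between \<open>I\<close> and \<open>I'\<close>.\<close>

lemma degree_ne_7:
  assumes v: "v \<in> V" shows "card (N c v) \<noteq> 7"
proof
  assume "card (N c v) = 7"
  then obtain w I T where s: "split7 c v w I T" using split7_exists[OF v] by blast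
  then have Nv: "N c v = insert w (I \<union> T)" and w: "w \<notin> I \<union> T" and IT: "I \<inter> T = {}" and cI: "card I = 3"
    and blueI: "\<And>x y. x \<in> I \<Longrightarrow> y \<in> I \<union> T \<Longrightarrow> x \<noteq> y \<Longrightarrow> E (\<not> c) x y"
    unfolding split7_def clique_def by auto
  have subV: "insert w (I \<union> T) \<subseteq> V" using Nv N_sub[of c v] by simp
  have vE: "E c v x" if "x \<in> insert w (I \<union> T)" for x using that Nv unfolding nbh_def by auto
  have Ed: "E (\<not> c) x y \<longleftrightarrow> \<not> E c x y" if "x \<noteq> y" for x y using that by (rule adj_other)
  obtain i j k where ijk: "I = {i, j, k}" "distinct [i, j, k]" using cI card_3_iff[of I] by auto
  have i: "i \<in> I" "j \<in> I" "k \<in> I" using ijk by auto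
  have "card (N c i) = 7" using split7_inner[OF s i(1)] by blast
  moreover have iV: "i \<in> V" using i subV by auto
  ultimately obtain w' I' T' where s': "split7 c i w' I' T'" using split7_exists by blast
  then have Ni: "N c i = insert w' (I' \<union> T')" and w': "w' \<notin> I' \<union> T'" and I'T': "I' \<inter> T' = {}"
    and cI': "card I' = 3" "card T' = 3"
    and blueI': "\<And>x y. x \<in> I' \<Longrightarrow> y \<in> I' \<Longrightarrow> x \<noteq> y \<Longrightarrow> E (\<not> c) x y"
    and redT': "\<And>x y. x \<in> T' \<Longrightarrow> y \<in> T' \<Longrightarrow> x \<noteq> y \<Longrightarrow> E c x y"
    unfolding split7_def clique_def by auto
  have w'I': "E c w' x" if "x \<in> I'" for x using split7_inner[OF s' that] by blast
  have only_w: "y = w" if y: "y \<in> N c i" "E c v y" for y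
  proof (rule ccontr)
    assume "y \<noteq> w"
    have "y \<in> V" using y N_sub by blast
    then have "y \<in> I \<union> T" using y(2) \<open>y \<noteq> w\<close> Nv unfolding nbh_def by blast
    then show False using blueI[OF i(1), of y] y(1) Ed[of i y] E_irrefl unfolding nbh_def by blast
  qed
  have "v \<in> N c i" using vE[of i] i E_sym v unfolding nbh_def by blast
  then consider "v = w'" | "v \<in> T'" | "v \<in> I'" using Ni by blast
  then have vI': "v \<in> I'"
  proof cases
    case 1
    then have "I' \<subseteq> {w}" using only_w w'I' Ni by blast
    then show ?thesis using cI' card_mono[of "{w}" I'] by auto
  next
    case 2
    then have "T' - {v} \<subseteq> {w}" using only_w redT' Ni by blast
    then have "card (T' - {v}) \<le> 1" using card_mono[of "{w}" "T' - {v}"] by auto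
    then show ?thesis using cI' 2 by (simp add: card_Diff_singleton)
  qed
  then have ww: "w' = w" using only_w[of w'] w'I' Ni E_sym by blast
  have "card (I' - {v}) = 2" using cI' vI' by (simp add: card_Diff_singleton)
  then obtain b b' where b: "I' - {v} = {b, b'}" "b \<noteq> b'" by (auto simp: card_2_iff)
  have bI: "b \<in> I'" "b' \<in> I'" "b \<noteq> v" "b' \<noteq> v" using b by auto
  have off: "x \<in> V \<and> x \<notin> insert w (I \<union> T) \<and> E c i x \<and> E c w x" if x: "x \<in> {b, b'}" for x
  proof -
    have "E (\<not> c) v x" "v \<noteq> x" using blueI' vI' bI x by auto
    then have "\<not> E c v x" using Ed by blast
    then have "x \<notin> insert w (I \<union> T)" using vE by blast
    moreover have "x \<in> N c i" using Ni bI x by blast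
    ultimately show ?thesis using w'I' ww bI x unfolding nbh_def by auto
  qed
  obtain z where z: "N (\<not> c) j \<subseteq> insert z (I \<union> T)" using split7_inner[OF s i(2)] by blast
  have "\<exists>y y'. {y, y'} = {b, b'} \<and> E c j y'"
  proof (rule ccontr)
    assume "\<not> ?thesis"
    then have "\<not> E c j b" "\<not> E c j b'" by blast+
    moreover have "j \<noteq> b" "j \<noteq> b'" using off[of b] off[of b'] i by auto
    ultimately have "b \<in> N (\<not> c) j" "b' \<in> N (\<not> c) j" using Ed off unfolding nbh_def by auto
    then show False using z off[of b] off[of b'] b(2) by blast
  qed
  then obtain y y' where y: "{y, y'} = {b, b'}" "E c j y'" by blast
  have yb: "y \<in> {b, b'}" "y' \<in> {b, b'}" "y \<noteq> y'" using y(1) b(2) by (blast, blast, metis doubleton_eq_iff)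
  have wI: "E c w x" if "x \<in> I" for x using split7_inner[OF s that] by blast
  have wv: "E c w v" using vE[of w] E_sym by blast
  have vI: "v \<notin> insert w (I \<union> T)" using vE E_irrefl by blast
  show False
  proof (rule fanD[of w v k i y j y' c])
    show "distinct [w, v, k, i, y, j, y']"
      using off[OF yb(1)] off[OF yb(2)] yb w vI i ijk(2) bI by auto
    show "{w, v, k, i, y, j, y'} \<subseteq> V" using off[OF yb(1)] off[OF yb(2)] v subV i by auto
    show "E c w v" "E c j y'" by fact+
    show "E c v k" using vE i by blast
  qed (use off[OF yb(1)] off[OF yb(2)] wI i in auto)
qed

lemma no_fan_free_colouring: False
proof -
  have "V \<noteq> {}" using card14 by auto
  then obtain v where v: "v \<in> V" by blast
  show False
    using degree_sum[OF v, of True] degree_le_7[OF v, of True] degree_le_7[OF v, of False]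
      degree_ne_7[OF v, of True] degree_ne_7[OF v, of False] by auto
qed

end

section \<open>Monochromatic copies of the fan\<close>

lemma mono_copy_of_embedding:
  fixes g :: "'a \<Rightarrow> nat"
  assumes H: "simple_graph H" and g: "inj_on g (verts H)" "g ` verts H \<subseteq> {..<N}"
    and mono: "\<And>e. e \<in> edges H \<Longrightarrow> \<chi> (g ` e) = c"
  shows "mono_copy (complete_graph N) \<chi> H"
proof -
  let ?K = "(g ` verts H, (`) g ` edges H)"
  have HE: "edges H \<subseteq> [verts H]\<^bsup>2\<^esup>" using H unfolding simple_graph_def by simp
  have KE: "(`) g ` edges H \<subseteq> [g ` verts H]\<^bsup>2\<^esup>"
  proof clarify
    fix e assume "e \<in> edges H"
    then have "e \<subseteq> verts H" "finite e" "card e = 2" using HE unfolding nsets_def by auto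
    then show "g ` e \<in> [g ` verts H]\<^bsup>2\<^esup>"
      using card_image[of g e] inj_on_subset[OF g(1)] unfolding nsets_def by auto
  qed
  have "subgraph ?K (complete_graph N)"
    using H g(2) KE nsets_mono[OF g(2), of 2]
    unfolding subgraph_def simple_graph_def complete_graph_def by auto
  moreover have "graph_iso H ?K"
    unfolding graph_iso_def
  proof (intro exI[of _ g] conjI ballI)
    show "bij_betw g (verts H) (verts ?K)" using g(1) by (simp add: bij_betw_def)
    fix u v assume uv: "u \<in> verts H" "v \<in> verts H"
    have "{u, v} \<in> edges H" if "e \<in> edges H" "{g u, g v} = g ` e" for e
    proof -
      have "e \<subseteq> verts H" using HE that(1) unfolding nsets_def by auto
      then have "{u, v} = e"
        using inj_on_image_eq_iff[OF g(1), of "{u, v}" e] uv that(2) by auto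
      then show ?thesis using that(1) by simp
    qed
    moreover have "{g u, g v} \<in> edges ?K" if "{u, v} \<in> edges H"
      using imageI[OF that, of "(`) g"] by simp
    ultimately show "{u, v} \<in> edges H \<longleftrightarrow> {g u, g v} \<in> edges ?K" by auto
  qed
  moreover have "\<forall>e\<in>edges ?K. \<chi> e = c" using mono by auto
  ultimately show ?thesis unfolding mono_copy_def by blast
qed

lemma fan_3_edges:
  "edges (fan 3) = {{0, 1}, {0, 2}, {0, 3}, {0, 4}, {0, 5}, {0, 6}, {1, 2}, {3, 4}, {5, 6}}"
proof -
  have "{1..6::nat} = {1, 2, 3, 4, 5, 6}" by auto
  then have "{{0, v} | v. v \<in> {1..6}} = (\<lambda>v. {0, v}) ` {1, 2, 3, 4, 5, 6::nat}"
    by (simp only: Setcompr_eq_image Collect_mem_eq)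
  then show ?thesis unfolding edges_fan_3 by (simp only: image_insert image_empty Un_insert_left Un_empty_left)
qed

lemma fan_3_verts: "verts (fan 3) = {0, 1, 2, 3, 4, 5, 6}"
  unfolding fan_def by (auto simp: numeral_eq_Suc atMost_Suc)

text \<open>Six edges of the fan meet its centre, and they turn into membership in a neighbourhood; the
  other three are disjoint. The truth value \<open>c\<close> says whether the copy is red.\<close>

lemma mono_copy_fan_3_iff:
  "mono_copy (complete_graph N) \<chi> (fan 3) \<longleftrightarrow>
     (\<exists>c. \<exists>v<N. has_matching3 (adj (\<lambda>x y. \<chi> {x, y} = Red) c) (nbh {..<N} (\<lambda>x y. \<chi> {x, y} = Red) c v))"
  (is "?L \<longleftrightarrow> ?R")
proof
  assume ?L
  then obtain K c g where K: "subgraph K (complete_graph N)" and mono: "\<forall>e\<in>edges K. \<chi> e = c"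
    and g: "bij_betw g (verts (fan 3)) (verts K)"
    and iso: "\<forall>u\<in>verts (fan 3). \<forall>v\<in>verts (fan 3). {u, v} \<in> edges (fan 3) \<longleftrightarrow> {g u, g v} \<in> edges K"
    unfolding mono_copy_def graph_iso_def by blast
  have lt: "g x < N" if "x \<in> {0, 1, 2, 3, 4, 5, 6}" for x
    using bij_betwE[OF g] K that unfolding fan_3_verts subgraph_def complete_graph_def by auto
  have inj: "inj_on g {0, 1, 2, 3, 4, 5, 6}" using g unfolding bij_betw_def fan_3_verts by blast
  have col: "\<chi> {g x, g y} = c" if "{x, y} \<in> edges (fan 3)" for x y
  proof -
    have "{x, y} \<subseteq> verts (fan 3)" using that simple_graph_fan[of 3] unfolding simple_graph_def nsets_def by auto
    then show ?thesis using mono iso that by auto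
  qed
  let ?c = "c = Red"
  have eq: "(\<chi> {g x, g y} = Red) = ?c" if "{x, y} \<in> edges (fan 3)" for x y using col[OF that] by simp
  have dist: "distinct [g 0, g 1, g 2, g 3, g 4, g 5, g 6]"
  proof -
    have "distinct (map g [0, 1, 2, 3, 4, 5, 6])" unfolding distinct_map using inj by simp
    then show ?thesis by (simp only: list.map)
  qed
  let ?E = "adj (\<lambda>x y. \<chi> {x, y} = Red) ?c" and ?N = "nbh {..<N} (\<lambda>x y. \<chi> {x, y} = Red) ?c (g 0)"
  have adj: "?E (g x) (g y)" if "{x, y} \<in> edges (fan 3)" "g x \<noteq> g y" for x y
    using eq[OF that(1)] that(2) unfolding adj_def by blast
  have nb: "g x \<in> ?N" if "{0, x} \<in> edges (fan 3)" "x \<in> {0, 1, 2, 3, 4, 5, 6}" "g 0 \<noteq> g x" for x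
    using adj[OF that(1,3)] lt[OF that(2)] unfolding nbh_def by simp
  have "has_matching3 ?E ?N"
  proof (rule has_matching3I[of ?E "g 1" "g 2" "g 3" "g 4" "g 5" "g 6"])
    show "?E (g 1) (g 2)" "?E (g 3) (g 4)" "?E (g 5) (g 6)"
      by (rule adj; use dist in \<open>simp add: fan_3_edges\<close>)+
    show "g 1 \<in> ?N" "g 2 \<in> ?N" "g 3 \<in> ?N" "g 4 \<in> ?N" "g 5 \<in> ?N" "g 6 \<in> ?N"
      by (rule nb; use dist in \<open>simp add: fan_3_edges\<close>)+
    show "distinct [g 1, g 2, g 3, g 4, g 5, g 6]" using dist by simp
  qed
  then show ?R using lt by blast
next
  assume ?R
  then obtain c v where v: "v < N"
    and "has_matching3 (adj (\<lambda>x y. \<chi> {x, y} = Red) c) (nbh {..<N} (\<lambda>x y. \<chi> {x, y} = Red) c v)"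
    by blast
  then obtain a a' b b' d d' where dist: "distinct [a, a', b, b', d, d']"
    and sub: "{a, a', b, b', d, d'} \<subseteq> nbh {..<N} (\<lambda>x y. \<chi> {x, y} = Red) c v"
    and e: "adj (\<lambda>x y. \<chi> {x, y} = Red) c a a'" "adj (\<lambda>x y. \<chi> {x, y} = Red) c b b'"
      "adj (\<lambda>x y. \<chi> {x, y} = Red) c d d'"
    unfolding has_matching3_def by (elim exE conjE)
  define g where "g = (\<lambda>i. [v, a, a', b, b', d, d'] ! i)"
  have g: "g 0 = v" "g 1 = a" "g 2 = a'" "g 3 = b" "g 4 = b'" "g 5 = d" "g 6 = d'"
    unfolding g_def by simp_all
  let ?c = "if c then Red else Blue"
  have col: "\<chi> s = ?c" if "(\<chi> s = Red) = c" for s using that by (cases "\<chi> s") auto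
  show ?L
  proof (rule mono_copy_of_embedding[of _ g _ _ ?c])
    show "simple_graph (fan 3)" by (rule simple_graph_fan)
    show "inj_on g (verts (fan 3))"
    proof -
      have "v \<notin> {a, a', b, b', d, d'}" using sub unfolding nbh_def adj_def by blast
      then have "distinct (map g [0, 1, 2, 3, 4, 5, 6])" using dist by (simp add: g del: One_nat_def)
      then show ?thesis unfolding distinct_map fan_3_verts by simp
    qed
    show "g ` verts (fan 3) \<subseteq> {..<N}"
      using sub v unfolding fan_3_verts by (auto simp: g nbh_def simp del: One_nat_def)
    fix s assume s: "s \<in> edges (fan 3)"
    have "\<chi> {v, x} = ?c" if "x \<in> {a, a', b, b', d, d'}" for x
      using sub that by (intro col) (auto simp: nbh_def adj_def)
    then have "\<chi> {v, a} = ?c" "\<chi> {v, a'} = ?c" "\<chi> {v, b} = ?c" "\<chi> {v, b'} = ?c" "\<chi> {v, d} = ?c"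
      "\<chi> {v, d'} = ?c" by blast+
    moreover have "\<chi> {a, a'} = ?c" "\<chi> {b, b'} = ?c" "\<chi> {d, d'} = ?c"
      by (rule col; use e in \<open>simp add: adj_def\<close>)+
    ultimately have "\<forall>t\<in>(`) g ` edges (fan 3). \<chi> t = ?c"
      unfolding fan_3_edges by (simp add: g del: One_nat_def)
    then show "\<chi> (g ` s) = ?c" using s by blast
  qed
qed

section \<open>A colouring of thirteen vertices and the Ramsey number\<close>

text \<open>The offset makes \<open>0\<close> a part of its own; the vertices \<open>1\<close> to
  \<open>12\<close> form the parts \<open>1\<close> to \<open>4\<close> of three consecutive numbers
  each.\<close>

definition pentagon_part :: "nat \<Rightarrow> nat" where
  "pentagon_part x = (x + 2) div 3"

text \<open>Cyclically consecutive parts are joined in red. The two parts joined in red to the single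
  vertex \<open>0\<close> are red inside, the other two are blue inside.\<close>

definition pentagon_colour :: "nat \<Rightarrow> nat \<Rightarrow> bool" where
  "pentagon_colour x y = (let p = pentagon_part x; q = pentagon_part y in
     if p = q then p = 1 \<or> p = 4 else (p + 1) mod 5 = q \<or> (q + 1) mod 5 = p)"

definition mono_edges :: "bool \<Rightarrow> nat \<Rightarrow> (nat \<times> nat) list" where
  "mono_edges c v = (let N = filter (\<lambda>x. x \<noteq> v \<and> pentagon_colour v x = c) [0..<13] in
     filter (\<lambda>(x, y). x < y \<and> pentagon_colour x y = c) (List.product N N))"

definition disjoint_pairs :: "nat \<times> nat \<Rightarrow> nat \<times> nat \<Rightarrow> bool" where
  "disjoint_pairs e e' \<longleftrightarrow> fst e \<noteq> fst e' \<and> fst e \<noteq> snd e' \<and> snd e \<noteq> fst e' \<and> snd e \<noteq> snd e'"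

definition triple_free :: "(nat \<times> nat) list \<Rightarrow> bool" where
  "triple_free es \<longleftrightarrow> list_all (\<lambda>e. let fs = filter (disjoint_pairs e) es in
     list_all (\<lambda>e'. \<not> list_ex (disjoint_pairs e') fs) fs) es"

text \<open>By reflection of the pentagon there are only three kinds of vertices. In the neighbourhood
  of the vertex \<open>0\<close>, in either colour, the edges of that colour form two disjoint
  triangles. For a vertex in a larger part and the colour used inside that part, all such edges in its
  neighbourhood meet the two other vertices of the part; for the other colour they form a single
  triangle. The proof checks this by simplification over the lists of edges.\<close>

lemma triple_free_mono_edges:
  "list_all (\<lambda>v. triple_free (mono_edges True v) \<and> triple_free (mono_edges False v)) [0..<13]"
  by code_simp

lemma pentagon_colour_sym: "pentagon_colour x y = pentagon_colour y x"
  unfolding pentagon_colour_def Let_def by auto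

lemma pentagon_colour_fan_free:
  assumes "v < 13"
  shows "\<not> has_matching3 (adj pentagon_colour c) (nbh {..<13} pentagon_colour c v)"
proof
  assume "has_matching3 (adj pentagon_colour c) (nbh {..<13} pentagon_colour c v)"
  then obtain a a' b b' d d' where dist: "distinct [a, a', b, b', d, d']"
    and sub: "{a, a', b, b', d, d'} \<subseteq> nbh {..<13} pentagon_colour c v"
    and e: "adj pentagon_colour c a a'" "adj pentagon_colour c b b'" "adj pentagon_colour c d d'"
    unfolding has_matching3_def by (elim exE conjE)
  define pr where "pr = (\<lambda>x y :: nat. (min x y, max x y))"
  have pr: "pr x y \<in> set (mono_edges c v)"
    if "adj pentagon_colour c x y" "x \<in> nbh {..<13} pentagon_colour c v" "y \<in> nbh {..<13} pentagon_colour c v"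
    for x y
    using that pentagon_colour_sym[of x y]
    unfolding mono_edges_def pr_def adj_def nbh_def Let_def by (auto simp: min_def max_def)
  have disj: "disjoint_pairs (pr x x') (pr y y')" if "distinct [x, x', y, y']" for x x' y y'
    using that unfolding disjoint_pairs_def pr_def by (auto simp: min_def max_def)
  have "triple_free (mono_edges c v)"
    using triple_free_mono_edges assms unfolding list_all_iff by (cases c) auto
  moreover have "pr a a' \<in> set (mono_edges c v)" "pr b b' \<in> set (mono_edges c v)" "pr d d' \<in> set (mono_edges c v)"
    using pr e sub by auto
  moreover have "disjoint_pairs (pr a a') (pr b b')" "disjoint_pairs (pr a a') (pr d d')"
    "disjoint_pairs (pr b b') (pr d d')" using dist by (intro disj; simp)+
  ultimately show False
    unfolding triple_free_def list_all_iff list_ex_iff Let_def set_filter mem_Collect_eq by blast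
qed

theorem theorem1p3:
  shows "ramsey_number (fan 3) = 14"
  unfolding ramsey_number_def
proof (rule Least_equality)
  show "\<forall>\<chi>. mono_copy (complete_graph 14) \<chi> (fan 3)"
  proof (rule allI, rule ccontr)
    fix \<chi>
    assume no: "\<not> mono_copy (complete_graph 14) \<chi> (fan 3)"
    interpret fan_free_14 "{..<14}" "\<lambda>x y. \<chi> {x, y} = Red"
    proof
      show "(\<chi> {x, y} = Red) = (\<chi> {y, x} = Red)" for x y by (simp add: insert_commute)
    qed (use no in \<open>auto simp: mono_copy_fan_3_iff\<close>)
    show False by (rule no_fan_free_colouring)
  qed
next
  fix N
  assume all: "\<forall>\<chi>. mono_copy (complete_graph N) \<chi> (fan 3)"
  show "14 \<le> N"
  proof (rule ccontr)
    assume "\<not> 14 \<le> N"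
    then have N: "N \<le> 13" by simp
    define \<chi> where "\<chi> = (\<lambda>e. if \<exists>x y. e = {x, y} \<and> pentagon_colour x y then Red else Blue)"
    have pentagon: "(\<lambda>x y. \<chi> {x, y} = Red) = pentagon_colour"
      using pentagon_colour_sym unfolding \<chi>_def by (intro ext) (auto simp: doubleton_eq_iff)
    obtain c v where v: "v < N"
      and m: "has_matching3 (adj pentagon_colour c) (nbh {..<N} pentagon_colour c v)"
      using all[rule_format, of \<chi>] unfolding mono_copy_fan_3_iff pentagon by blast
    have "nbh {..<N} pentagon_colour c v \<subseteq> nbh {..<13} pentagon_colour c v"
      using N unfolding nbh_def by auto
    then have "has_matching3 (adj pentagon_colour c) (nbh {..<13} pentagon_colour c v)"
      using m unfolding has_matching3_def by (meson order_trans)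
    then show False using pentagon_colour_fan_free[of v c] v N by simp
  qed
qed

end
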